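(* Let $G$ be a groupoid over $M$ in a tangent category, let $\pi:A\to M$ with anchor $\varrho$ be its associated anchored bundle, and define $\alpha:A\times_{\varrho,T(\pi)}T(A)\to T(A)$ by $$\alpha(v,w)=cw\circ 0v\circ(c0pw)^{-1}.$$ Then $\alpha$ satisfies the flip axiom: for all $v\in A$, $w\in T(A)$, $x\in T^2(A)$ with $\varrho v=T(\pi)w$ and $cT(\varrho)w=T^2(\pi)x$, $$T(\alpha)(\alpha(v,w),x)=cT(\alpha)\bigl(\alpha(v,px),\,cT(\alpha)(w,cx)\bigr).$$
   Context: Conventions: composition of arrows is juxtaposition in applicative order ($gf$: first $f$, then $g$); subscripts of natural transformations are omitted; elements are generalised elements. An additive bundle over $M$ is a commutative monoid in the slice category over $M$: an arrow $q:E\to M$, zero $\xi:M\to E$, addition $+_q$. A morphism is a commuting square preserving zero and addition. A tangent category is a category with an endofunctor $T$ and natural transformations $p:T\Rightarrow\mathrm{id}$, $0:\mathrm{id}\Rightarrow T$, $+:T\times_{p,p}T\Rightarrow T$, $l:T\Rightarrow T^2$, $c:T^2\Rightarrow T^2$ such that: pullback powers of $p$ exist and are preserved by $T$; each $(p_M,0_M,+_M)$ is an additive bundle; $(l,0):p\Rightarrow T(p)$ and $(c,\mathrm{id}):T(p)\Rightarrow p$ are additive bundle morphisms; $cc=\mathrm{id}$, $T(c)cT(c)=cT(c)c$, $cl=l$, $T(l)l=ll$, $cT(c)l=T(l)c$; and $\mu(a,b)=T(+)(0b,la)$, $T(M)\times_MT(M)\to T^2(M)$, is an equaliser of $T(p)$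 and $0pp$. Standing assumptions: negatives (additive bundles are commutative groups in the slice) and all limits used exist and are preserved by $T$. The groupoid $G$ has identity $e:M\to G$, source and target $s,t:G\to M$, inverse $(-)^{-1}$; $g\circ h$ is defined when $s(g)=t(h)$. In $T^2(G)$, $\circ$ and $(-)^{-1}$ denote the operations obtained by applying $T^2$, so $g\circ h$ is defined when $T^2(s)g=T^2(t)h$. Associated anchored bundle: $A$ is the pullback of $(p,T(s)):T(G)\to G\times T(M)$ along $(e,0):M\to G\times T(M)$, with projection $\pi:A\to M$ and monomorphism $\iota:A\rightarrowtail T(G)$. Thus elements of $A$ are $v\in T(G)$ with $pv=em$, $T(s)v=0m$, $m=\pi v$; elements of $T(A)$ are regarded as elements $w\in T^2(G)$ with $T(p)w=T(e)T(\pi)w$ and $T^2(s)w=T(0)T(\pi)w$. Zero section, addition and lift are inherited from $(T(G),p)$: $\xi=0e$, $\lambda v=lv$. The anchor is $\varrho=T(t)\iota:A\to T(M)$. The prolongation $A\times_{\varrho,T(\pi)}T(A)$ is the pullback of $\varrho$ and $T(\pi):T(A)\to T(M)$. The composite defining $\alpha(v,w)$ is defined in $T^2(G)$ and lies in $T(A)$. *)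

theory Defs
  imports Main
begin

section \<open>Categories and limits\<close>

record ('o, 'm) category =
  Obj :: "'o set"
  Arr :: "'m set"
  Dom :: "'m \<Rightarrow> 'o"
  Cod :: "'m \<Rightarrow> 'o"
  Id :: "'o \<Rightarrow> 'm"
  Comp :: "'m \<Rightarrow> 'm \<Rightarrow> 'm" (infixr "\<cdot>\<index>" 75)

definition hom :: "('o, 'm, 'z) category_scheme \<Rightarrow> 'o \<Rightarrow> 'o \<Rightarrow> 'm set" where
  "hom C X Y = {f \<in> Arr C. Dom C f = X \<and> Cod C f = Y}"

text \<open>Composition is in applicative order: \<open>g \<cdot> f\<close> is first \<open>f\<close>, then \<open>g\<close>.\<close>

locale category =
  fixes C :: "('o, 'm, 'z) category_scheme" (structure)
  assumes Dom_Obj: "f \<in> Arr C \<Longrightarrow> Dom C f \<in> Obj C"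
    and Cod_Obj: "f \<in> Arr C \<Longrightarrow> Cod C f \<in> Obj C"
    and Id_hom: "X \<in> Obj C \<Longrightarrow> Id C X \<in> hom C X X"
    and Comp_hom: "\<lbrakk>f \<in> hom C X Y; g \<in> hom C Y Z\<rbrakk> \<Longrightarrow> g \<cdot> f \<in> hom C X Z"
    and Comp_Id: "f \<in> hom C X Y \<Longrightarrow> f \<cdot> Id C X = f"
    and Id_Comp: "f \<in> hom C X Y \<Longrightarrow> Id C Y \<cdot> f = f"
    and Comp_assoc:
      "\<lbrakk>f \<in> hom C X Y; g \<in> hom C Y Z; h \<in> hom C Z W\<rbrakk> \<Longrightarrow> (h \<cdot> g) \<cdot> f = h \<cdot> (g \<cdot> f)"

text \<open>Limits are given by their projections only; the apex is the common domain of these.\<close>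

text \<open>\<open>a\<close> and \<open>b\<close> are the projections of a pullback of \<open>f\<close> and \<open>g\<close>.\<close>
definition pullback ::
  "('o, 'm, 'z) category_scheme \<Rightarrow> 'm \<Rightarrow> 'm \<Rightarrow> 'm \<Rightarrow> 'm \<Rightarrow> bool" where
  "pullback C f g a b \<longleftrightarrow>
     f \<in> Arr C \<and> g \<in> Arr C \<and> Cod C f = Cod C g \<and>
     a \<in> hom C (Dom C a) (Dom C f) \<and> b \<in> hom C (Dom C a) (Dom C g) \<and>
     Comp C f a = Comp C g b \<and>
     (\<forall>X x y. x \<in> hom C X (Dom C f) \<and> y \<in> hom C X (Dom C g) \<and> Comp C f x = Comp C g y \<longrightarrow>
        (\<exists>!u. u \<in> hom C X (Dom C a) \<and> Comp C a u = x \<and> Comp C b u = y))"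

text \<open>\<open>a\<close> and \<open>b\<close> are the projections of a product of their codomains.\<close>
definition binary_product ::
  "('o, 'm, 'z) category_scheme \<Rightarrow> 'm \<Rightarrow> 'm \<Rightarrow> bool" where
  "binary_product C a b \<longleftrightarrow>
     a \<in> Arr C \<and> b \<in> Arr C \<and> Dom C a = Dom C b \<and>
     (\<forall>X x y. x \<in> hom C X (Cod C a) \<and> y \<in> hom C X (Cod C b) \<longrightarrow>
        (\<exists>!u. u \<in> hom C X (Dom C a) \<and> Comp C a u = x \<and> Comp C b u = y))"

definition equaliser ::
  "('o, 'm, 'z) category_scheme \<Rightarrow> 'm \<Rightarrow> 'm \<Rightarrow> 'm \<Rightarrow> bool" where
  "equaliser C f g k \<longleftrightarrow>
     f \<in> Arr C \<and> g \<in> Arr C \<and> Dom C f = Dom C g \<and> Cod C f = Cod C g \<and>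
     k \<in> hom C (Dom C k) (Dom C f) \<and> Comp C f k = Comp C g k \<and>
     (\<forall>X x. x \<in> hom C X (Dom C f) \<and> Comp C f x = Comp C g x \<longrightarrow>
        (\<exists>!u. u \<in> hom C X (Dom C k) \<and> Comp C k u = x))"

text \<open>The \<open>n\<close>-th power of \<open>q\<close> in the slice over its codomain; \<open>b\<close> is the structure map to
  the base, which for \<open>n > 0\<close> is determined by the projections \<open>pr i\<close>.\<close>
definition pullback_power ::
  "('o, 'm, 'z) category_scheme \<Rightarrow> nat \<Rightarrow> 'm \<Rightarrow> 'm \<Rightarrow> (nat \<Rightarrow> 'm) \<Rightarrow> bool" where
  "pullback_power C n q b pr \<longleftrightarrow>
     q \<in> Arr C \<and> b \<in> hom C (Dom C b) (Cod C q) \<and>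
     (\<forall>i<n. pr i \<in> hom C (Dom C b) (Dom C q) \<and> Comp C q (pr i) = b) \<and>
     (\<forall>X y x. y \<in> hom C X (Cod C q) \<and>
          (\<forall>i<n. x i \<in> hom C X (Dom C q) \<and> Comp C q (x i) = y) \<longrightarrow>
        (\<exists>!u. u \<in> hom C X (Dom C b) \<and> Comp C b u = y \<and> (\<forall>i<n. Comp C (pr i) u = x i)))"

text \<open>The arrow \<open>(x, y)\<close> into the apex of the pullback or product with projections
  \<open>a\<close>, \<open>b\<close>.\<close>
definition pair :: "('o, 'm, 'z) category_scheme \<Rightarrow> 'm \<Rightarrow> 'm \<Rightarrow> 'm \<Rightarrow> 'm \<Rightarrow> 'm" where
  "pair C a b x y =
     (THE u. u \<in> hom C (Dom C x) (Dom C a) \<and> Comp C a u = x \<and> Comp C b u = y)"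

definition natural_transformation ::
  "('o, 'm, 'z) category_scheme \<Rightarrow> ('o \<Rightarrow> 'o) \<Rightarrow> ('m \<Rightarrow> 'm) \<Rightarrow> ('o \<Rightarrow> 'o) \<Rightarrow> ('m \<Rightarrow> 'm)
     \<Rightarrow> ('o \<Rightarrow> 'm) \<Rightarrow> bool" where
  "natural_transformation C Fo Fa Go Ga \<tau> \<longleftrightarrow>
     (\<forall>X\<in>Obj C. \<tau> X \<in> hom C (Fo X) (Go X)) \<and>
     (\<forall>X Y. \<forall>f\<in>hom C X Y. Comp C (Ga f) (\<tau> X) = Comp C (\<tau> Y) (Fa f))"


section \<open>Additive bundles\<close>

text \<open>\<open>bsq1\<close>, \<open>bsq2\<close> are the projections of the pullback of \<open>bproj\<close> with itself on which
  \<open>badd\<close> is defined.\<close>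
record 'm bundle_data =
  bproj :: 'm
  bzero :: 'm
  bsq1 :: 'm
  bsq2 :: 'm
  badd :: 'm

definition fibre_sum :: "('o, 'm, 'z) category_scheme \<Rightarrow> 'm bundle_data \<Rightarrow> 'm \<Rightarrow> 'm \<Rightarrow> 'm" where
  "fibre_sum C B x y = Comp C (badd B) (pair C (bsq1 B) (bsq2 B) x y)"

text \<open>The commutative monoid laws are stated on generalised elements of the total object.\<close>
definition additive_bundle :: "('o, 'm, 'z) category_scheme \<Rightarrow> 'm bundle_data \<Rightarrow> bool" where
  "additive_bundle C B \<longleftrightarrow>
     (let q = bproj B; E = Dom C q; M = Cod C q; E2 = Dom C (bsq1 B) in
       q \<in> Arr C \<and>
       bzero B \<in> hom C M E \<and> Comp C q (bzero B) = Id C M \<and>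
       pullback C q q (bsq1 B) (bsq2 B) \<and>
       badd B \<in> hom C E2 E \<and> Comp C q (badd B) = Comp C q (bsq1 B) \<and>
       (\<forall>X. \<forall>x\<in>hom C X E. fibre_sum C B (Comp C (bzero B) (Comp C q x)) x = x) \<and>
       (\<forall>X. \<forall>x\<in>hom C X E. \<forall>y\<in>hom C X E. Comp C q x = Comp C q y \<longrightarrow>
          fibre_sum C B x y = fibre_sum C B y x) \<and>
       (\<forall>X. \<forall>x\<in>hom C X E. \<forall>y\<in>hom C X E. \<forall>z\<in>hom C X E.
          Comp C q x = Comp C q y \<and> Comp C q y = Comp C q z \<longrightarrow>
          fibre_sum C B (fibre_sum C B x y) z = fibre_sum C B x (fibre_sum C B y z)))"

definition has_negatives :: "('o, 'm, 'z) category_scheme \<Rightarrow> 'm bundle_data \<Rightarrow> bool" where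
  "has_negatives C B \<longleftrightarrow>
     (let q = bproj B; E = Dom C q in
       \<exists>m\<in>hom C E E. Comp C q m = q \<and>
         (\<forall>X. \<forall>x\<in>hom C X E.
            fibre_sum C B x (Comp C m x) = Comp C (bzero B) (Comp C q x)))"

text \<open>\<open>f\<close> is the map of total objects, \<open>g\<close> the map of bases.\<close>
definition additive_morphism ::
  "('o, 'm, 'z) category_scheme \<Rightarrow> 'm bundle_data \<Rightarrow> 'm bundle_data \<Rightarrow> 'm \<Rightarrow> 'm \<Rightarrow> bool" where
  "additive_morphism C B B' f g \<longleftrightarrow>
     (let q = bproj B; q' = bproj B'; E = Dom C q in
       f \<in> hom C E (Dom C q') \<and> g \<in> hom C (Cod C q) (Cod C q') \<and>
       Comp C q' f = Comp C g q \<and>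
       Comp C f (bzero B) = Comp C (bzero B') g \<and>
       (\<forall>X. \<forall>x\<in>hom C X E. \<forall>y\<in>hom C X E. Comp C q x = Comp C q y \<longrightarrow>
          Comp C f (fibre_sum C B x y) = fibre_sum C B' (Comp C f x) (Comp C f y)))"


section \<open>Tangent categories\<close>

text \<open>\<open>tsq1 M\<close>, \<open>tsq2 M\<close> are the projections of the domain \<open>T(M) \<times>\<^bsub>p,p\<^esub> T(M)\<close> of the
  addition \<open>tadd M\<close>.\<close>
record ('o, 'm) tangent_category = "('o, 'm) category" +
  TOb :: "'o \<Rightarrow> 'o"
  TAr :: "'m \<Rightarrow> 'm"
  tproj :: "'o \<Rightarrow> 'm"
  tzero :: "'o \<Rightarrow> 'm"
  tsq1 :: "'o \<Rightarrow> 'm"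
  tsq2 :: "'o \<Rightarrow> 'm"
  tadd :: "'o \<Rightarrow> 'm"
  tlift :: "'o \<Rightarrow> 'm"
  tflip :: "'o \<Rightarrow> 'm"

text \<open>That a limit is preserved by \<open>T\<close> means that every iterate \<open>T\<^sup>n\<close> sends it to a limit;
  the case \<open>n = 0\<close> says that it is a limit in the first place.\<close>

definition preserved_pullback ::
  "('o, 'm, 'z) tangent_category_scheme \<Rightarrow> 'm \<Rightarrow> 'm \<Rightarrow> 'm \<Rightarrow> 'm \<Rightarrow> bool" where
  "preserved_pullback C f g a b \<longleftrightarrow>
     (\<forall>n. pullback C ((TAr C ^^ n) f) ((TAr C ^^ n) g) ((TAr C ^^ n) a) ((TAr C ^^ n) b))"

definition preserved_product ::
  "('o, 'm, 'z) tangent_category_scheme \<Rightarrow> 'm \<Rightarrow> 'm \<Rightarrow> bool" where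
  "preserved_product C a b \<longleftrightarrow>
     (\<forall>n. binary_product C ((TAr C ^^ n) a) ((TAr C ^^ n) b))"

definition preserved_pullback_power ::
  "('o, 'm, 'z) tangent_category_scheme \<Rightarrow> nat \<Rightarrow> 'm \<Rightarrow> 'm \<Rightarrow> (nat \<Rightarrow> 'm) \<Rightarrow> bool" where
  "preserved_pullback_power C k q b pr \<longleftrightarrow>
     (\<forall>n. pullback_power C k ((TAr C ^^ n) q) ((TAr C ^^ n) b) (\<lambda>i. (TAr C ^^ n) (pr i)))"

definition tangent_bundle :: "('o, 'm, 'z) tangent_category_scheme \<Rightarrow> 'o \<Rightarrow> 'm bundle_data" where
  "tangent_bundle C M =
     \<lparr>bproj = tproj C M, bzero = tzero C M, bsq1 = tsq1 C M, bsq2 = tsq2 C M, badd = tadd C M\<rparr>"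

definition T_bundle :: "('o, 'm, 'z) tangent_category_scheme \<Rightarrow> 'm bundle_data \<Rightarrow> 'm bundle_data" where
  "T_bundle C B =
     \<lparr>bproj = TAr C (bproj B), bzero = TAr C (bzero B),
      bsq1 = TAr C (bsq1 B), bsq2 = TAr C (bsq2 B), badd = TAr C (badd B)\<rparr>"

text \<open>The functor \<open>M \<mapsto> T(M) \<times>\<^bsub>p,p\<^esub> T(M)\<close> on arrows.\<close>
definition T2_map :: "('o, 'm, 'z) tangent_category_scheme \<Rightarrow> 'm \<Rightarrow> 'm" where
  "T2_map C f =
     (let X = Dom C f; Y = Cod C f in
       pair C (tsq1 C Y) (tsq2 C Y) (Comp C (TAr C f) (tsq1 C X)) (Comp C (TAr C f) (tsq2 C X)))"

text \<open>\<open>\<mu>(a, b) = T(+)(0 b, l a)\<close>, at the universal element \<open>(a, b)\<close>.\<close>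
definition vertical_lift :: "('o, 'm, 'z) tangent_category_scheme \<Rightarrow> 'o \<Rightarrow> 'm" where
  "vertical_lift C M =
     Comp C (TAr C (tadd C M))
       (pair C (TAr C (tsq1 C M)) (TAr C (tsq2 C M))
          (Comp C (tzero C (TOb C M)) (tsq2 C M))
          (Comp C (tlift C M) (tsq1 C M)))"

text \<open>Negatives are part of the definition.\<close>

locale tangent_category = category C
  for C :: "('o, 'm, 'z) tangent_category_scheme" (structure) +
  assumes T_Obj: "X \<in> Obj C \<Longrightarrow> TOb C X \<in> Obj C"
    and T_hom: "f \<in> hom C X Y \<Longrightarrow> TAr C f \<in> hom C (TOb C X) (TOb C Y)"
    and T_Id: "X \<in> Obj C \<Longrightarrow> TAr C (Id C X) = Id C (TOb C X)"
    and T_Comp: "\<lbrakk>f \<in> hom C X Y; g \<in> hom C Y Z\<rbrakk> \<Longrightarrow> TAr C (g \<cdot> f) = TAr C g \<cdot> TAr C f"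
    and proj_natural:
      "natural_transformation C (TOb C) (TAr C) id id (tproj C)"
    and zero_natural:
      "natural_transformation C id id (TOb C) (TAr C) (tzero C)"
    and add_natural:
      "natural_transformation C (\<lambda>M. Dom C (tsq1 C M)) (T2_map C) (TOb C) (TAr C) (tadd C)"
    and lift_natural:
      "natural_transformation C (TOb C) (TAr C) (TOb C \<circ> TOb C) (TAr C \<circ> TAr C) (tlift C)"
    and flip_natural:
      "natural_transformation C (TOb C \<circ> TOb C) (TAr C \<circ> TAr C)
         (TOb C \<circ> TOb C) (TAr C \<circ> TAr C) (tflip C)"
    and square_preserved:
      "M \<in> Obj C \<Longrightarrow> preserved_pullback C (tproj C M) (tproj C M) (tsq1 C M) (tsq2 C M)"
    and powers_preserved:
      "M \<in> Obj C \<Longrightarrow> \<exists>b pr. preserved_pullback_power C k (tproj C M) b pr"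
    and tangent_bundle_additive:
      "M \<in> Obj C \<Longrightarrow> additive_bundle C (tangent_bundle C M)"
    and tangent_bundle_negatives:
      "M \<in> Obj C \<Longrightarrow> has_negatives C (tangent_bundle C M)"
    and lift_additive:
      "M \<in> Obj C \<Longrightarrow>
         additive_morphism C (tangent_bundle C M) (T_bundle C (tangent_bundle C M))
           (tlift C M) (tzero C M)"
    and flip_additive:
      "M \<in> Obj C \<Longrightarrow>
         additive_morphism C (T_bundle C (tangent_bundle C M)) (tangent_bundle C (TOb C M))
           (tflip C M) (Id C (TOb C M))"
    and flip_flip:
      "M \<in> Obj C \<Longrightarrow> tflip C M \<cdot> tflip C M = Id C (TOb C (TOb C M))"
    and flip_braid:
      "M \<in> Obj C \<Longrightarrow>
         TAr C (tflip C M) \<cdot> tflip C (TOb C M) \<cdot> TAr C (tflip C M)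
           = tflip C (TOb C M) \<cdot> TAr C (tflip C M) \<cdot> tflip C (TOb C M)"
    and flip_lift:
      "M \<in> Obj C \<Longrightarrow> tflip C M \<cdot> tlift C M = tlift C M"
    and lift_lift:
      "M \<in> Obj C \<Longrightarrow> TAr C (tlift C M) \<cdot> tlift C M = tlift C (TOb C M) \<cdot> tlift C M"
    and flip_flip_lift:
      "M \<in> Obj C \<Longrightarrow>
         tflip C (TOb C M) \<cdot> TAr C (tflip C M) \<cdot> tlift C (TOb C M)
           = TAr C (tlift C M) \<cdot> tflip C M"
    and vertical_lift_equaliser:
      "M \<in> Obj C \<Longrightarrow>
         equaliser C (TAr C (tproj C M)) (tzero C M \<cdot> tproj C M \<cdot> tproj C (TOb C M))
           (vertical_lift C M)"


section \<open>Groupoids\<close>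

text \<open>\<open>gfst\<close>, \<open>gsnd\<close> are the projections of the object of composable pairs \<open>(g, h)\<close>,
  \<open>s g = t h\<close>, on which the multiplication \<open>gmul\<close> is defined.\<close>
record ('o, 'm) groupoid =
  gtot :: 'o
  gbase :: 'o
  gsrc :: 'm
  gtgt :: 'm
  gunit :: 'm
  ginv :: 'm
  gfst :: 'm
  gsnd :: 'm
  gmul :: 'm

text \<open>The operations obtained from those of the groupoid by applying \<open>T\<^sup>n\<close>, on generalised
  elements of \<open>T\<^sup>n(G)\<close>.\<close>

definition gcomp ::
  "('o, 'm, 'z) tangent_category_scheme \<Rightarrow> ('o, 'm) groupoid \<Rightarrow> nat \<Rightarrow> 'm \<Rightarrow> 'm \<Rightarrow> 'm" where
  "gcomp C G n g h =
     Comp C ((TAr C ^^ n) (gmul G)) (pair C ((TAr C ^^ n) (gfst G)) ((TAr C ^^ n) (gsnd G)) g h)"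

definition ginverse ::
  "('o, 'm, 'z) tangent_category_scheme \<Rightarrow> ('o, 'm) groupoid \<Rightarrow> nat \<Rightarrow> 'm \<Rightarrow> 'm" where
  "ginverse C G n g = Comp C ((TAr C ^^ n) (ginv G)) g"

text \<open>\<open>triples_preserved\<close> concerns the object of composable triples, as the pullback over \<open>G\<close>
  of two copies of the object of composable pairs.\<close>
locale internal_groupoid =
  fixes C :: "('o, 'm, 'z) tangent_category_scheme" (structure)
    and G :: "('o, 'm) groupoid"
  assumes tot_Obj: "gtot G \<in> Obj C"
    and base_Obj: "gbase G \<in> Obj C"
    and src_hom: "gsrc G \<in> hom C (gtot G) (gbase G)"
    and tgt_hom: "gtgt G \<in> hom C (gtot G) (gbase G)"
    and unit_hom: "gunit G \<in> hom C (gbase G) (gtot G)"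
    and inv_hom: "ginv G \<in> hom C (gtot G) (gtot G)"
    and pairs_preserved: "preserved_pullback C (gsrc G) (gtgt G) (gfst G) (gsnd G)"
    and triples_preserved: "\<exists>a b. preserved_pullback C (gsnd G) (gfst G) a b"
    and mul_hom: "gmul G \<in> hom C (Dom C (gfst G)) (gtot G)"
    and src_unit: "gsrc G \<cdot> gunit G = Id C (gbase G)"
    and tgt_unit: "gtgt G \<cdot> gunit G = Id C (gbase G)"
    and src_comp:
      "\<lbrakk>g \<in> hom C X (gtot G); h \<in> hom C X (gtot G); gsrc G \<cdot> g = gtgt G \<cdot> h\<rbrakk>
        \<Longrightarrow> gsrc G \<cdot> gcomp C G 0 g h = gsrc G \<cdot> h"
    and tgt_comp:
      "\<lbrakk>g \<in> hom C X (gtot G); h \<in> hom C X (gtot G); gsrc G \<cdot> g = gtgt G \<cdot> h\<rbrakk>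
        \<Longrightarrow> gtgt G \<cdot> gcomp C G 0 g h = gtgt G \<cdot> g"
    and comp_assoc:
      "\<lbrakk>g \<in> hom C X (gtot G); h \<in> hom C X (gtot G); k \<in> hom C X (gtot G);
        gsrc G \<cdot> g = gtgt G \<cdot> h; gsrc G \<cdot> h = gtgt G \<cdot> k\<rbrakk>
        \<Longrightarrow> gcomp C G 0 (gcomp C G 0 g h) k = gcomp C G 0 g (gcomp C G 0 h k)"
    and comp_unit:
      "g \<in> hom C X (gtot G) \<Longrightarrow> gcomp C G 0 g (gunit G \<cdot> gsrc G \<cdot> g) = g"
    and unit_comp:
      "g \<in> hom C X (gtot G) \<Longrightarrow> gcomp C G 0 (gunit G \<cdot> gtgt G \<cdot> g) g = g"
    and src_inv: "gsrc G \<cdot> ginv G = gtgt G"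
    and tgt_inv: "gtgt G \<cdot> ginv G = gsrc G"
    and comp_inv:
      "g \<in> hom C X (gtot G) \<Longrightarrow> gcomp C G 0 g (ginverse C G 0 g) = gunit G \<cdot> gtgt G \<cdot> g"
    and inv_comp:
      "g \<in> hom C X (gtot G) \<Longrightarrow> gcomp C G 0 (ginverse C G 0 g) g = gunit G \<cdot> gsrc G \<cdot> g"


section \<open>The associated anchored bundle and its prolongation\<close>

text \<open>\<open>\<pi> : A \<rightarrow> M\<close> is the projection, \<open>\<iota> : A \<rightarrow> T(G)\<close> the inclusion and \<open>\<rho> : A \<rightarrow> T(M)\<close> the
  anchor; \<open>q1\<close>, \<open>q2\<close> are the projections of the product \<open>G \<times> T(M)\<close>. The induced zero section,
  addition and lift of \<open>A\<close> play no role below and are omitted.\<close>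
definition associated_anchored_bundle ::
  "('o, 'm, 'z) tangent_category_scheme \<Rightarrow> ('o, 'm) groupoid \<Rightarrow> 'o \<Rightarrow> 'm \<Rightarrow> 'm \<Rightarrow> 'm \<Rightarrow> bool"
where
  "associated_anchored_bundle C G A \<pi> \<iota> \<rho> \<longleftrightarrow>
     \<iota> \<in> hom C A (TOb C (gtot G)) \<and> \<pi> \<in> hom C A (gbase G) \<and>
     (\<exists>q1 q2.
        Cod C q1 = gtot G \<and> Cod C q2 = TOb C (gbase G) \<and> preserved_product C q1 q2 \<and>
        preserved_pullback C
          (pair C q1 q2 (tproj C (gtot G)) (TAr C (gsrc G)))
          (pair C q1 q2 (gunit G) (tzero C (gbase G)))
          \<iota> \<pi>) \<and>
     \<rho> = Comp C (TAr C (gtgt G)) \<iota>"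

text \<open>The element \<open>c w \<circ> 0 v \<circ> (c 0 p w)\<inverse>\<close> of \<open>T\<^sup>2(G)\<close>, for elements \<open>v\<close> of \<open>A\<close> and \<open>w\<close> of
  \<open>T(A)\<close>, regarded as elements of \<open>T(G)\<close> and \<open>T\<^sup>2(G)\<close> along \<open>\<iota>\<close> and \<open>T(\<iota>)\<close>.\<close>
definition alpha_element ::
  "('o, 'm, 'z) tangent_category_scheme \<Rightarrow> ('o, 'm) groupoid \<Rightarrow> 'm \<Rightarrow> 'm \<Rightarrow> 'm \<Rightarrow> 'm" where
  "alpha_element C G \<iota> v w =
     (let v' = Comp C \<iota> v;
          w' = Comp C (TAr C \<iota>) w;
          c = tflip C (gtot G);
          z = tzero C (TOb C (gtot G));
          p = tproj C (TOb C (gtot G))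
      in gcomp C G 2
           (gcomp C G 2 (Comp C c w') (Comp C z v'))
           (ginverse C G 2 (Comp C c (Comp C z (Comp C p w')))))"

text \<open>The arrow \<open>\<alpha>\<close> from the prolongation, with projections \<open>r1\<close> and \<open>r2\<close>, to \<open>T(A)\<close> that
  satisfies \<open>\<alpha>(v, w) = c w \<circ> 0 v \<circ> (c 0 p w)\<inverse>\<close> on generalised elements.\<close>
definition alpha ::
  "('o, 'm, 'z) tangent_category_scheme \<Rightarrow> ('o, 'm) groupoid \<Rightarrow> 'o \<Rightarrow> 'm \<Rightarrow> 'm \<Rightarrow> 'm
     \<Rightarrow> 'm \<Rightarrow> 'm \<Rightarrow> 'm" where
  "alpha C G A \<pi> \<iota> \<rho> r1 r2 =
     (THE a. a \<in> hom C (Dom C r1) (TOb C A) \<and>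
        (\<forall>X. \<forall>v\<in>hom C X A. \<forall>w\<in>hom C X (TOb C A).
           Comp C \<rho> v = Comp C (TAr C \<pi>) w \<longrightarrow>
           Comp C (TAr C \<iota>) (Comp C a (pair C r1 r2 v w)) = alpha_element C G \<iota> v w))"

end

theory Submission
  imports Defs
begin

text \<open>
  Write \<open>x\<close>, \<open>w\<close>, \<open>v\<close> also for the corresponding elements of \<open>T\<^sup>3(G)\<close>, \<open>T\<^sup>2(G)\<close>, \<open>T(G)\<close>. As
  \<open>c 0 = T(0)\<close>, the definition of \<open>\<alpha>\<close> reads \<open>\<alpha>(v, w) = c w \<circ> 0 v \<circ> (T(0) p w)\<inverse>\<close>, and applying
  \<open>T\<close> gives \<open>T(\<alpha>)(y, x) = T(c) x \<circ> T(0) y \<circ> (T\<^sup>2(0) T(p) x)\<inverse>\<close>. The natural transformations \<open>p\<close>,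
  \<open>0\<close>, \<open>c\<close> and their images under \<open>T\<close> are functors between the groupoids \<open>T\<^sup>n(G)\<close>
  (\<open>groupoid_morphism_cmp\<close>), so both sides of the flip axiom expand into products in \<open>T\<^sup>3(G)\<close>. With
  \<open>a = T(c) x\<close>, \<open>b = T(0) c w\<close>, \<open>v' = 0 0 v\<close>, \<open>p' = T(0) T(0) p w\<close>, \<open>q = T\<^sup>2(0) T(p) x\<close>,
  \<open>k = 0 c p x\<close> and \<open>l = 0 T(0) p p x\<close>, the left-hand side is
  \<open>a \<circ> (b \<circ> v' \<circ> p'\<inverse>) \<circ> q\<inverse>\<close>. The right-hand side is
  \<open>(a \<circ> b \<circ> k\<inverse>) \<circ> (k \<circ> v' \<circ> l\<inverse>) \<circ> (q \<circ> p' \<circ> l\<inverse>)\<inverse>\<close>, the factor \<open>a\<close> in it because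
  \<open>c T(c) c T(c) c = T(c)\<close> by the braid relation. The two agree in any groupoid
  (\<open>conjugation_identity\<close>), and \<open>T\<^sup>2(\<iota>)\<close> is monic (\<open>incl_monic\<close>).

  Two preliminaries are needed: the groupoid laws in \<open>T\<^sup>n(G)\<close>, which follow from those in \<open>G\<close>
  because \<open>T\<close> preserves the objects of composable pairs and triples, and the fact that the element
  defining \<open>\<alpha>(v, w)\<close> lies in \<open>T(A)\<close> (\<open>alpha_exists\<close>).
\<close>

section \<open>Arrows and limits in a category\<close>

lemma ex1_eqD: "\<lbrakk>\<exists>!x. P x; P a; P b\<rbrakk> \<Longrightarrow> a = b"
  by blast

lemma funpow_2 [simp]: "(f ^^ 2) x = f (f x)"
  and funpow_3 [simp]: "(f ^^ 3) x = f (f (f x))"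
  by (simp_all add: eval_nat_numeral)

text \<open>Typing of arrows is reduced to equations between domains and codomains, which the
  simplifier decides.\<close>
lemma in_hom_iff [simp]: "f \<in> hom C X Y \<longleftrightarrow> f \<in> Arr C \<and> Dom C f = X \<and> Cod C f = Y"
  by (auto simp: hom_def)

context category
begin

lemma Comp_Arr [simp]:
  assumes "f \<in> Arr C" "g \<in> Arr C" "Cod C f = Dom C g"
  shows "g \<cdot> f \<in> Arr C" "Dom C (g \<cdot> f) = Dom C f" "Cod C (g \<cdot> f) = Cod C g"
  using Comp_hom[of f "Dom C f" "Dom C g" g "Cod C g"] assms by auto

lemma Id_Arr [simp]:
  assumes "X \<in> Obj C"
  shows "Id C X \<in> Arr C" "Dom C (Id C X) = X" "Cod C (Id C X) = X"
  using Id_hom[OF assms] by auto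

lemma Dom_Cod_Obj [simp]: "f \<in> Arr C \<Longrightarrow> Dom C f \<in> Obj C" "f \<in> Arr C \<Longrightarrow> Cod C f \<in> Obj C"
  by (auto intro: Dom_Obj Cod_Obj)

lemma Comp_Id' [simp]: "\<lbrakk>f \<in> Arr C; X = Dom C f\<rbrakk> \<Longrightarrow> f \<cdot> Id C X = f"
  using Comp_Id by simp

lemma Id_Comp' [simp]: "\<lbrakk>f \<in> Arr C; X = Cod C f\<rbrakk> \<Longrightarrow> Id C X \<cdot> f = f"
  using Id_Comp by simp

lemma Comp_assoc' [simp]:
  "\<lbrakk>f \<in> Arr C; g \<in> Arr C; h \<in> Arr C; Cod C f = Dom C g; Cod C g = Dom C h\<rbrakk>
    \<Longrightarrow> (h \<cdot> g) \<cdot> f = h \<cdot> (g \<cdot> f)"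
  by (rule Comp_assoc) auto

text \<open>All compositions are kept associated to the right, so every equation between composites is
  needed in a form applied to a further element \<open>u\<close>.\<close>
lemma Comp_square_applied:
  assumes "f \<cdot> g = h \<cdot> k"
    and "u \<in> Arr C" "g \<in> Arr C" "f \<in> Arr C" "h \<in> Arr C" "k \<in> Arr C"
    and "Cod C u = Dom C g" "Cod C g = Dom C f" "Cod C u = Dom C k" "Cod C k = Dom C h"
  shows "f \<cdot> (g \<cdot> u) = h \<cdot> (k \<cdot> u)"
proof -
  have "f \<cdot> (g \<cdot> u) = (f \<cdot> g) \<cdot> u" using assms(2-) by simp
  also have "\<dots> = h \<cdot> (k \<cdot> u)" unfolding assms(1) using assms(2-) by simp
  finally show ?thesis .
qed

lemma pair_pullback:
  assumes "pullback C f g a b"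
    and "x \<in> hom C X (Dom C f)" "y \<in> hom C X (Dom C g)" "f \<cdot> x = g \<cdot> y"
  shows "pair C a b x y \<in> hom C X (Dom C a)" "a \<cdot> pair C a b x y = x" "b \<cdot> pair C a b x y = y"
proof -
  have "\<exists>!u. u \<in> hom C X (Dom C a) \<and> a \<cdot> u = x \<and> b \<cdot> u = y"
    using assms unfolding pullback_def by blast
  moreover have "Dom C x = X" using assms by simp
  ultimately have "pair C a b x y \<in> hom C X (Dom C a) \<and>
      a \<cdot> pair C a b x y = x \<and> b \<cdot> pair C a b x y = y"
    unfolding pair_def by (auto dest!: theI')
  then show "pair C a b x y \<in> hom C X (Dom C a)" "a \<cdot> pair C a b x y = x"
    "b \<cdot> pair C a b x y = y" by auto
qed

lemma pullback_jointly_monic: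
  assumes pb: "pullback C f g a b"
    and u: "u \<in> hom C X (Dom C a)" and u': "u' \<in> hom C X (Dom C a)"
    and a: "a \<cdot> u = a \<cdot> u'" and b: "b \<cdot> u = b \<cdot> u'"
  shows "u = u'"
proof -
  have f: "f \<in> Arr C" "g \<in> Arr C" "Cod C f = Cod C g" "a \<in> hom C (Dom C a) (Dom C f)"
    "b \<in> hom C (Dom C a) (Dom C g)" "f \<cdot> a = g \<cdot> b"
    using pb unfolding pullback_def by blast+
  have "f \<cdot> (a \<cdot> u) = g \<cdot> (b \<cdot> u)"
    using f u by (intro Comp_square_applied) auto
  moreover have "a \<cdot> u \<in> hom C X (Dom C f)" "b \<cdot> u \<in> hom C X (Dom C g)" using f u by auto
  ultimately have "\<exists>!u'. u' \<in> hom C X (Dom C a) \<and> a \<cdot> u' = a \<cdot> u \<and> b \<cdot> u' = b \<cdot> u"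
    using pb unfolding pullback_def by blast
  then show ?thesis by (rule ex1_eqD) (use u u' a b in auto)
qed

lemma pair_pullback_unique:
  assumes pb: "pullback C f g a b" and u: "u \<in> hom C X (Dom C a)"
  shows "pair C a b (a \<cdot> u) (b \<cdot> u) = u"
proof -
  have f: "f \<in> Arr C" "g \<in> Arr C" "Cod C f = Cod C g" "a \<in> hom C (Dom C a) (Dom C f)"
    "b \<in> hom C (Dom C a) (Dom C g)" "f \<cdot> a = g \<cdot> b"
    using pb unfolding pullback_def by blast+
  have *: "f \<cdot> (a \<cdot> u) = g \<cdot> (b \<cdot> u)"
    using f u by (intro Comp_square_applied) auto
  note p = pair_pullback[OF pb _ _ *, of X]
  show ?thesis
    by (rule pullback_jointly_monic[OF pb, of _ X]) (use f u p in simp_all)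
qed

lemma pair_product:
  assumes "binary_product C a b"
    and "x \<in> hom C X (Cod C a)" "y \<in> hom C X (Cod C b)"
  shows "pair C a b x y \<in> hom C X (Dom C a)" "a \<cdot> pair C a b x y = x" "b \<cdot> pair C a b x y = y"
proof -
  have "\<exists>!u. u \<in> hom C X (Dom C a) \<and> a \<cdot> u = x \<and> b \<cdot> u = y"
    using assms unfolding binary_product_def by blast
  moreover have "Dom C x = X" using assms by simp
  ultimately have "pair C a b x y \<in> hom C X (Dom C a) \<and>
      a \<cdot> pair C a b x y = x \<and> b \<cdot> pair C a b x y = y"
    unfolding pair_def by (auto dest!: theI')
  then show "pair C a b x y \<in> hom C X (Dom C a)" "a \<cdot> pair C a b x y = x"
    "b \<cdot> pair C a b x y = y" by auto
qed

lemma product_jointly_monic: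
  assumes "binary_product C a b"
    and "u \<in> hom C X (Dom C a)" and "u' \<in> hom C X (Dom C a)"
    and "a \<cdot> u = a \<cdot> u'" and "b \<cdot> u = b \<cdot> u'"
  shows "u = u'"
proof -
  have "a \<in> Arr C" "b \<in> Arr C" "Dom C a = Dom C b"
    using assms(1) unfolding binary_product_def by blast+
  then have "a \<cdot> u \<in> hom C X (Cod C a)" "b \<cdot> u \<in> hom C X (Cod C b)"
    using assms(2) by auto
  then have "\<exists>!u'. u' \<in> hom C X (Dom C a) \<and> a \<cdot> u' = a \<cdot> u \<and> b \<cdot> u' = b \<cdot> u"
    using assms(1) unfolding binary_product_def by blast
  then show ?thesis by (rule ex1_eqD) (use assms(2-) in auto)
qed

end

section \<open>Identities of the tangent structure\<close>

context tangent_category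
begin

abbreviation "T \<equiv> TAr C"

lemma TOb_Obj [simp]: "X \<in> Obj C \<Longrightarrow> TOb C X \<in> Obj C"
  by (rule T_Obj)

lemma TAr_Arr [simp]:
  assumes "f \<in> Arr C"
  shows "T f \<in> Arr C" "Dom C (T f) = TOb C (Dom C f)" "Cod C (T f) = TOb C (Cod C f)"
  using T_hom[of f "Dom C f" "Cod C f"] assms by auto

lemma TAr_Comp [simp]:
  "\<lbrakk>f \<in> Arr C; g \<in> Arr C; Cod C f = Dom C g\<rbrakk> \<Longrightarrow> T (g \<cdot> f) = T g \<cdot> T f"
  by (rule T_Comp) auto

lemma TAr_Id [simp]: "X \<in> Obj C \<Longrightarrow> T (Id C X) = Id C (TOb C X)"
  by (rule T_Id)

lemma funpow_TOb_Obj [simp]: "X \<in> Obj C \<Longrightarrow> (TOb C ^^ n) X \<in> Obj C"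
  by (induction n) auto

lemma funpow_TAr_Arr [simp]:
  assumes "f \<in> Arr C"
  shows "(T ^^ n) f \<in> Arr C" "Dom C ((T ^^ n) f) = (TOb C ^^ n) (Dom C f)"
    "Cod C ((T ^^ n) f) = (TOb C ^^ n) (Cod C f)"
  using assms by (induction n) auto

lemma funpow_TAr_Comp:
  assumes "f \<in> Arr C" "g \<in> Arr C" "Cod C f = Dom C g"
  shows "(T ^^ n) (g \<cdot> f) = (T ^^ n) g \<cdot> (T ^^ n) f"
  using assms by (induction n) auto

lemma funpow_TAr_Id: "X \<in> Obj C \<Longrightarrow> (T ^^ n) (Id C X) = Id C ((TOb C ^^ n) X)"
  by (induction n) auto

lemma tproj_Arr [simp]:
  assumes "X \<in> Obj C"
  shows "tproj C X \<in> Arr C" "Dom C (tproj C X) = TOb C X" "Cod C (tproj C X) = X"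
  using proj_natural assms unfolding natural_transformation_def by auto

lemma tzero_Arr [simp]:
  assumes "X \<in> Obj C"
  shows "tzero C X \<in> Arr C" "Dom C (tzero C X) = X" "Cod C (tzero C X) = TOb C X"
  using zero_natural assms unfolding natural_transformation_def by auto

lemma tflip_Arr [simp]:
  assumes "X \<in> Obj C"
  shows "tflip C X \<in> Arr C" "Dom C (tflip C X) = TOb C (TOb C X)"
    "Cod C (tflip C X) = TOb C (TOb C X)"
  using flip_natural assms unfolding natural_transformation_def by auto

lemma tproj_TAr:
  assumes "f \<in> Arr C" shows "tproj C (Cod C f) \<cdot> T f = f \<cdot> tproj C (Dom C f)"
  using proj_natural assms unfolding natural_transformation_def by auto

lemma TAr_tzero:
  assumes "f \<in> Arr C" shows "T f \<cdot> tzero C (Dom C f) = tzero C (Cod C f) \<cdot> f"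
  using zero_natural assms unfolding natural_transformation_def by auto

lemma TAr_tflip:
  assumes "f \<in> Arr C" shows "T (T f) \<cdot> tflip C (Dom C f) = tflip C (Cod C f) \<cdot> T (T f)"
  using flip_natural assms unfolding natural_transformation_def by auto

lemma tproj_tzero:
  assumes "X \<in> Obj C" shows "tproj C X \<cdot> tzero C X = Id C X"
  using tangent_bundle_additive[OF assms] assms
  by (simp add: additive_bundle_def tangent_bundle_def Let_def)

lemma tproj_tflip:
  assumes "X \<in> Obj C" shows "tproj C (TOb C X) \<cdot> tflip C X = T (tproj C X)"
  using flip_additive[OF assms] assms
  by (simp add: additive_morphism_def tangent_bundle_def T_bundle_def Let_def)

lemma tflip_T_tzero:
  assumes "X \<in> Obj C" shows "tflip C X \<cdot> T (tzero C X) = tzero C (TOb C X)"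
  using flip_additive[OF assms] assms
  by (simp add: additive_morphism_def tangent_bundle_def T_bundle_def Let_def)

lemma T_tproj_tflip:
  assumes "X \<in> Obj C" shows "T (tproj C X) \<cdot> tflip C X = tproj C (TOb C X)"
  using assms by (simp add: tproj_tflip[symmetric] flip_flip)

lemma tflip_tzero:
  assumes "X \<in> Obj C" shows "tflip C X \<cdot> tzero C (TOb C X) = T (tzero C X)"
proof -
  have "tflip C X \<cdot> tflip C X \<cdot> T (tzero C X) = T (tzero C X)"
    using assms Comp_assoc'[of "T (tzero C X)" "tflip C X" "tflip C X"] flip_flip by auto
  then show ?thesis using assms by (simp add: tflip_T_tzero)
qed

text \<open>Oriented this way, naturality moves \<open>p\<close> to the right and \<open>0\<close> and \<open>c\<close> to the left.\<close>
lemma tproj_TAr':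
  "\<lbrakk>f \<in> Arr C; Cod C f = Y; u \<in> Arr C; Cod C u = TOb C (Dom C f)\<rbrakk>
    \<Longrightarrow> tproj C Y \<cdot> T f \<cdot> u = f \<cdot> tproj C (Dom C f) \<cdot> u"
  using tproj_TAr[of f] by (intro Comp_square_applied) auto

lemma TAr_tzero':
  "\<lbrakk>f \<in> Arr C; Dom C f = Y; u \<in> Arr C; Cod C u = Dom C f\<rbrakk>
    \<Longrightarrow> T f \<cdot> tzero C Y \<cdot> u = tzero C (Cod C f) \<cdot> f \<cdot> u"
  using TAr_tzero[of f] by (intro Comp_square_applied) auto

lemma TAr_tflip':
  "\<lbrakk>f \<in> Arr C; Dom C f = Y; u \<in> Arr C; Cod C u = TOb C (TOb C (Dom C f))\<rbrakk>
    \<Longrightarrow> T (T f) \<cdot> tflip C Y \<cdot> u = tflip C (Cod C f) \<cdot> T (T f) \<cdot> u"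
  using TAr_tflip[of f] by (intro Comp_square_applied) auto

text \<open>The images under \<open>T\<close> of the same naturality squares.\<close>
lemma T_applied:
  assumes "f \<cdot> g = h \<cdot> k" "f \<in> hom C Y Z" "g \<in> hom C X Y" "h \<in> hom C Y' Z" "k \<in> hom C X Y'"
    and "u \<in> Arr C" "Cod C u = TOb C X"
  shows "T f \<cdot> T g \<cdot> u = T h \<cdot> T k \<cdot> u"
  by (rule Comp_square_applied) (use assms in \<open>auto simp: TAr_Comp[symmetric] simp del: TAr_Comp\<close>)

lemma T_tproj_TAr':
  "\<lbrakk>f \<in> Arr C; Cod C f = Y; u \<in> Arr C; Cod C u = TOb C (TOb C (Dom C f))\<rbrakk>
    \<Longrightarrow> T (tproj C Y) \<cdot> T (T f) \<cdot> u = T f \<cdot> T (tproj C (Dom C f)) \<cdot> u"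
  using tproj_TAr[of f] by (intro T_applied) auto

lemma T_TAr_tzero':
  "\<lbrakk>f \<in> Arr C; Dom C f = Y; u \<in> Arr C; Cod C u = TOb C (Dom C f)\<rbrakk>
    \<Longrightarrow> T (T f) \<cdot> T (tzero C Y) \<cdot> u = T (tzero C (Cod C f)) \<cdot> T f \<cdot> u"
  using TAr_tzero[of f] by (intro T_applied) auto

lemma T_TAr_tflip':
  "\<lbrakk>f \<in> Arr C; Dom C f = Y; u \<in> Arr C; Cod C u = TOb C (TOb C (TOb C (Dom C f)))\<rbrakk>
    \<Longrightarrow> T (T (T f)) \<cdot> T (tflip C Y) \<cdot> u = T (tflip C (Cod C f)) \<cdot> T (T (T f)) \<cdot> u"
  using TAr_tflip[of f] by (intro T_applied) auto

lemma TT_TAr_tzero':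
  "\<lbrakk>f \<in> Arr C; Dom C f = Y; u \<in> Arr C; Cod C u = TOb C (TOb C (Dom C f))\<rbrakk>
    \<Longrightarrow> T (T (T f)) \<cdot> T (T (tzero C Y)) \<cdot> u = T (T (tzero C (Cod C f))) \<cdot> T (T f) \<cdot> u"
  using TAr_tzero[of f] by (intro T_applied) (auto simp: TAr_Comp[symmetric] simp del: TAr_Comp)

lemma Comp_eq_applied:
  assumes "f \<cdot> g = h" "f \<in> hom C Y Z" "g \<in> hom C X Y" "h \<in> hom C X Z"
    and "u \<in> Arr C" "Cod C u = X"
  shows "f \<cdot> g \<cdot> u = h \<cdot> u"
proof -
  have "(f \<cdot> g) \<cdot> u = h \<cdot> u" by (simp only: assms(1))
  then show ?thesis using assms(2-) by simp
qed

lemma T_Comp_eq: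
  assumes "f \<cdot> g = h" "f \<in> hom C Y Z" "g \<in> hom C X Y"
  shows "T f \<cdot> T g = T h"
  using assms TAr_Comp[of g f] by simp

text \<open>The relations between \<open>p\<close>, \<open>0\<close> and \<open>c\<close> and their images under \<open>T\<close>, oriented so that each one
  removes a projection or a flip.\<close>
lemma tangent_simps:
  assumes "X \<in> Obj C" "u \<in> Arr C"
  shows "Cod C u = X \<Longrightarrow> tproj C X \<cdot> tzero C X \<cdot> u = u"
    and "Cod C u = TOb C X \<Longrightarrow> T (tproj C X) \<cdot> T (tzero C X) \<cdot> u = u"
    and "Cod C u = TOb C (TOb C X) \<Longrightarrow> tproj C (TOb C X) \<cdot> tflip C X \<cdot> u = T (tproj C X) \<cdot> u"
    and "Cod C u = TOb C (TOb C X) \<Longrightarrow> T (tproj C X) \<cdot> tflip C X \<cdot> u = tproj C (TOb C X) \<cdot> u"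
    and "Cod C u = TOb C X \<Longrightarrow> tflip C X \<cdot> tzero C (TOb C X) \<cdot> u = T (tzero C X) \<cdot> u"
    and "Cod C u = TOb C X \<Longrightarrow> tflip C X \<cdot> T (tzero C X) \<cdot> u = tzero C (TOb C X) \<cdot> u"
    and "Cod C u = TOb C (TOb C X) \<Longrightarrow> tflip C X \<cdot> tflip C X \<cdot> u = u"
    and "Cod C u = TOb C (TOb C X) \<Longrightarrow>
        T (tflip C X) \<cdot> T (tzero C (TOb C X)) \<cdot> u = T (T (tzero C X)) \<cdot> u"
    and "Cod C u = TOb C (TOb C X) \<Longrightarrow>
        T (tflip C X) \<cdot> T (T (tzero C X)) \<cdot> u = T (tzero C (TOb C X)) \<cdot> u"
proof -
  show "Cod C u = X \<Longrightarrow> tproj C X \<cdot> tzero C X \<cdot> u = u"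
    by (subst Comp_eq_applied[OF tproj_tzero]) (use assms in auto)
  show "Cod C u = TOb C X \<Longrightarrow> T (tproj C X) \<cdot> T (tzero C X) \<cdot> u = u"
    by (subst Comp_eq_applied[OF T_Comp_eq[OF tproj_tzero]]) (use assms in auto)
  show "Cod C u = TOb C (TOb C X) \<Longrightarrow> tproj C (TOb C X) \<cdot> tflip C X \<cdot> u = T (tproj C X) \<cdot> u"
    by (subst Comp_eq_applied[OF tproj_tflip]) (use assms in auto)
  show "Cod C u = TOb C (TOb C X) \<Longrightarrow> T (tproj C X) \<cdot> tflip C X \<cdot> u = tproj C (TOb C X) \<cdot> u"
    by (subst Comp_eq_applied[OF T_tproj_tflip]) (use assms in auto)
  show "Cod C u = TOb C X \<Longrightarrow> tflip C X \<cdot> tzero C (TOb C X) \<cdot> u = T (tzero C X) \<cdot> u"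
    by (subst Comp_eq_applied[OF tflip_tzero]) (use assms in auto)
  show "Cod C u = TOb C X \<Longrightarrow> tflip C X \<cdot> T (tzero C X) \<cdot> u = tzero C (TOb C X) \<cdot> u"
    by (subst Comp_eq_applied[OF tflip_T_tzero]) (use assms in auto)
  show "Cod C u = TOb C (TOb C X) \<Longrightarrow> tflip C X \<cdot> tflip C X \<cdot> u = u"
    by (subst Comp_eq_applied[OF flip_flip]) (use assms in auto)
  show "Cod C u = TOb C (TOb C X) \<Longrightarrow>
        T (tflip C X) \<cdot> T (tzero C (TOb C X)) \<cdot> u = T (T (tzero C X)) \<cdot> u"
    by (subst Comp_eq_applied[OF T_Comp_eq[OF tflip_tzero]]) (use assms in auto)
  show "Cod C u = TOb C (TOb C X) \<Longrightarrow>
        T (tflip C X) \<cdot> T (T (tzero C X)) \<cdot> u = T (tzero C (TOb C X)) \<cdot> u"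
    by (subst Comp_eq_applied[OF T_Comp_eq[OF tflip_T_tzero]]) (use assms in auto)
qed

text \<open>The braid relation \<open>T(c) c T(c) = c T(c) c\<close> with \<open>c c = id\<close>.\<close>
lemma flip_braid':
  assumes Y: "Y \<in> Obj C" and u: "u \<in> Arr C" "Cod C u = TOb C (TOb C (TOb C Y))"
  shows "tflip C (TOb C Y) \<cdot> T (tflip C Y) \<cdot> tflip C (TOb C Y) \<cdot> T (tflip C Y) \<cdot> tflip C (TOb C Y) \<cdot> u
    = T (tflip C Y) \<cdot> u"
proof -
  let ?c = "tflip C (TOb C Y)" and ?d = "T (tflip C Y)"
  have braid: "?c \<cdot> ?d \<cdot> ?c \<cdot> k = ?d \<cdot> ?c \<cdot> ?d \<cdot> k" if "k \<in> Arr C" "Cod C k = TOb C (TOb C (TOb C Y))" for k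
  proof -
    have "(?c \<cdot> ?d \<cdot> ?c) \<cdot> k = (?d \<cdot> ?c \<cdot> ?d) \<cdot> k" using flip_braid[OF Y] by simp
    then show ?thesis using that Y by simp
  qed
  have dd: "?d \<cdot> ?d \<cdot> k = k" if "k \<in> Arr C" "Cod C k = TOb C (TOb C (TOb C Y))" for k
    using that Y Comp_eq_applied[OF T_Comp_eq[OF flip_flip[OF Y]], where u = k] by simp
  have "?c \<cdot> ?d \<cdot> ?c \<cdot> ?d \<cdot> ?c \<cdot> u = ?d \<cdot> ?c \<cdot> ?d \<cdot> ?d \<cdot> ?c \<cdot> u"
    by (rule braid) (use Y u in simp_all)
  also have "\<dots> = ?d \<cdot> u" using Y u dd[of "?c \<cdot> u"] by (simp add: tangent_simps)
  finally show ?thesis .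
qed

text \<open>Naturality alone does not normalise this composite: the flip has to pass to the right of
  \<open>T\<^sup>2(0)\<close>, against the orientation chosen for \<open>c\<close>.\<close>
lemma flip_flip_zero:
  assumes Y: "Y \<in> Obj C" and u: "u \<in> Arr C" "Cod C u = TOb C (TOb C Y)"
  shows "T (tflip C Y) \<cdot> tflip C (TOb C Y) \<cdot> T (T (tzero C Y)) \<cdot> u
    = T (tzero C (TOb C Y)) \<cdot> tflip C Y \<cdot> u"
proof -
  have "tflip C (TOb C Y) \<cdot> T (T (tzero C Y)) \<cdot> u = T (T (tzero C Y)) \<cdot> tflip C Y \<cdot> u"
    using TAr_tflip'[of "tzero C Y" Y u] Y u by simp
  then show ?thesis using Y u by (simp add: tangent_simps)
qed

end

section \<open>The groupoid structure of iterated tangent bundles\<close>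

locale tangent_groupoid = tangent_category C + internal_groupoid C G
  for C :: "('o, 'm, 'z) tangent_category_scheme" (structure) and G :: "('o, 'm) groupoid"
begin

text \<open>At level \<open>n\<close> these are the structure of the groupoid \<open>T\<^sup>n(G)\<close>: total object, source, target,
  and on generalised elements the composite \<open>cmp n g h\<close> and the inverse \<open>recip n g\<close>. The arrow
  \<open>comp_pair n g h\<close> into the object of composable pairs has components \<open>g\<close> and \<open>h\<close>.\<close>
abbreviation "tot n \<equiv> (TOb C ^^ n) (gtot G)"
abbreviation "src n \<equiv> (T ^^ n) (gsrc G)"
abbreviation "tgt n \<equiv> (T ^^ n) (gtgt G)"
abbreviation "cmp \<equiv> gcomp C G"
abbreviation "recip \<equiv> ginverse C G"
abbreviation "comp_pair n \<equiv> pair C ((T ^^ n) (gfst G)) ((T ^^ n) (gsnd G))"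

text \<open>\<open>composable n g h\<close>: \<open>g\<close> and \<open>h\<close> are generalised elements of \<open>T\<^sup>n(G)\<close> at the same stage, and
  \<open>g \<circ> h\<close> is defined.\<close>
definition composable :: "nat \<Rightarrow> 'm \<Rightarrow> 'm \<Rightarrow> bool" where
  composable_iff: "composable n g h \<longleftrightarrow> g \<in> Arr C \<and> h \<in> Arr C \<and> Dom C h = Dom C g
     \<and> Cod C g = tot n \<and> Cod C h = tot n \<and> src n \<cdot> g = tgt n \<cdot> h"

lemma structure_Arr [simp]:
  "gtot G \<in> Obj C" "gbase G \<in> Obj C"
  "gsrc G \<in> Arr C" "Dom C (gsrc G) = gtot G" "Cod C (gsrc G) = gbase G"
  "gtgt G \<in> Arr C" "Dom C (gtgt G) = gtot G" "Cod C (gtgt G) = gbase G"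
  "gunit G \<in> Arr C" "Dom C (gunit G) = gbase G" "Cod C (gunit G) = gtot G"
  "ginv G \<in> Arr C" "Dom C (ginv G) = gtot G" "Cod C (ginv G) = gtot G"
  "gmul G \<in> Arr C" "Dom C (gmul G) = Dom C (gfst G)" "Cod C (gmul G) = gtot G"
  using tot_Obj base_Obj src_hom tgt_hom unit_hom inv_hom mul_hom by auto

lemma pairs_pullback: "pullback C (src n) (tgt n) ((T ^^ n) (gfst G)) ((T ^^ n) (gsnd G))"
  using pairs_preserved unfolding preserved_pullback_def by blast

lemma pairs_Arr [simp]:
  "gfst G \<in> Arr C" "Cod C (gfst G) = gtot G"
  "gsnd G \<in> Arr C" "Dom C (gsnd G) = Dom C (gfst G)" "Cod C (gsnd G) = gtot G"
  and src_fst: "gsrc G \<cdot> gfst G = gtgt G \<cdot> gsnd G"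
proof -
  have "gfst G \<in> hom C (Dom C (gfst G)) (Dom C (gsrc G))"
    "gsnd G \<in> hom C (Dom C (gfst G)) (Dom C (gtgt G))"
    and *: "gsrc G \<cdot> gfst G = gtgt G \<cdot> gsnd G"
    using pairs_pullback[of 0] unfolding pullback_def by simp_all
  then show "gfst G \<in> Arr C" "Cod C (gfst G) = gtot G"
    "gsnd G \<in> Arr C" "Dom C (gsnd G) = Dom C (gfst G)" "Cod C (gsnd G) = gtot G" by auto
  show "gsrc G \<cdot> gfst G = gtgt G \<cdot> gsnd G" by (rule *)
qed

lemma comp_pair:
  assumes "composable n g h"
  shows "comp_pair n g h \<in> hom C (Dom C g) ((TOb C ^^ n) (Dom C (gfst G)))"
    and "(T ^^ n) (gfst G) \<cdot> comp_pair n g h = g"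
    and "(T ^^ n) (gsnd G) \<cdot> comp_pair n g h = h"
  using pair_pullback[OF pairs_pullback, of g "Dom C g" n h] assms
  by (simp_all add: composable_iff)

lemma comp_pair_Arr [simp]:
  assumes "composable n g h"
  shows "comp_pair n g h \<in> Arr C" "Dom C (comp_pair n g h) = Dom C g"
    "Cod C (comp_pair n g h) = (TOb C ^^ n) (Dom C (gfst G))"
  using comp_pair[OF assms] by auto

lemma comp_pair_unique:
  assumes "u \<in> hom C X ((TOb C ^^ n) (Dom C (gfst G)))"
  shows "comp_pair n ((T ^^ n) (gfst G) \<cdot> u) ((T ^^ n) (gsnd G) \<cdot> u) = u"
  using pair_pullback_unique[OF pairs_pullback, of u X n] assms by simp

lemma cmp_Arr [simp]:
  assumes "composable n g h"
  shows "cmp n g h \<in> Arr C" "Dom C (cmp n g h) = Dom C g" "Cod C (cmp n g h) = tot n"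
  using assms by (simp_all add: gcomp_def)

lemma recip_Arr [simp]:
  assumes "g \<in> Arr C" "Cod C g = tot n"
  shows "recip n g \<in> Arr C" "Dom C (recip n g) = Dom C g" "Cod C (recip n g) = tot n"
  using assms by (simp_all add: ginverse_def)

lemma composable_Comp:
  assumes "composable n g h" "u \<in> Arr C" "Cod C u = Dom C g"
  shows "composable n (g \<cdot> u) (h \<cdot> u)"
  using assms by (auto simp: composable_iff intro!: Comp_square_applied)

lemma cmp_Comp:
  assumes "composable n g h" "u \<in> Arr C" "Cod C u = Dom C g"
  shows "cmp n g h \<cdot> u = cmp n (g \<cdot> u) (h \<cdot> u)"
proof -
  have "comp_pair n g h \<cdot> u = comp_pair n ((T ^^ n) (gfst G) \<cdot> comp_pair n g h \<cdot> u)
     ((T ^^ n) (gsnd G) \<cdot> comp_pair n g h \<cdot> u)"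
    using comp_pair_unique[of "comp_pair n g h \<cdot> u" "Dom C u" n] assms by simp
  also have "(T ^^ n) (gfst G) \<cdot> comp_pair n g h \<cdot> u = g \<cdot> u"
    using Comp_assoc'[of u "comp_pair n g h" "(T ^^ n) (gfst G)"] comp_pair[of n g h] assms
    by simp
  also have "(T ^^ n) (gsnd G) \<cdot> comp_pair n g h \<cdot> u = h \<cdot> u"
    using Comp_assoc'[of u "comp_pair n g h" "(T ^^ n) (gsnd G)"] comp_pair[of n g h] assms
    by simp
  finally show ?thesis using assms by (simp add: gcomp_def)
qed

lemma recip_Comp:
  assumes "g \<in> Arr C" "u \<in> Arr C" "Cod C g = tot n" "Cod C u = Dom C g"
  shows "recip n g \<cdot> u = recip n (g \<cdot> u)"
  using assms by (simp add: ginverse_def)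

lemma T_composable: "composable n g h \<Longrightarrow> composable (Suc n) (T g) (T h)"
  by (auto simp: composable_iff TAr_Comp[symmetric] simp del: TAr_Comp)

lemma T_cmp:
  assumes "composable n g h"
  shows "T (cmp n g h) = cmp (Suc n) (T g) (T h)"
proof -
  have "T (comp_pair n g h) = comp_pair (Suc n) ((T ^^ Suc n) (gfst G) \<cdot> T (comp_pair n g h))
     ((T ^^ Suc n) (gsnd G) \<cdot> T (comp_pair n g h))"
    using comp_pair_unique[of "T (comp_pair n g h)" "TOb C (Dom C g)" "Suc n"] assms by simp
  also have "(T ^^ Suc n) (gfst G) \<cdot> T (comp_pair n g h) = T ((T ^^ n) (gfst G) \<cdot> comp_pair n g h)"
    using assms by simp
  also have "\<dots> = T g" using comp_pair(2)[OF assms] by simp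
  also have "(T ^^ Suc n) (gsnd G) \<cdot> T (comp_pair n g h) = T ((T ^^ n) (gsnd G) \<cdot> comp_pair n g h)"
    using assms by simp
  also have "\<dots> = T h" using comp_pair(3)[OF assms] by simp
  finally show ?thesis using assms by (simp add: gcomp_def)
qed

lemma T_recip: "\<lbrakk>g \<in> Arr C; Cod C g = tot n\<rbrakk> \<Longrightarrow> T (recip n g) = recip (Suc n) (T g)"
  by (simp add: ginverse_def)

lemma composable_universal: "composable n ((T ^^ n) (gfst G)) ((T ^^ n) (gsnd G))"
  using src_fst by (simp add: composable_iff funpow_TAr_Comp[symmetric])

lemma cmp_universal: "cmp n ((T ^^ n) (gfst G)) ((T ^^ n) (gsnd G)) = (T ^^ n) (gmul G)"
proof -
  have "comp_pair n ((T ^^ n) (gfst G)) ((T ^^ n) (gsnd G))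
      = Id C ((TOb C ^^ n) (Dom C (gfst G)))"
    using comp_pair_unique[of "Id C ((TOb C ^^ n) (Dom C (gfst G)))" _ n] by simp
  then show ?thesis by (simp add: gcomp_def)
qed

lemma src_mul: "gsrc G \<cdot> gmul G = gsrc G \<cdot> gsnd G"
  and tgt_mul: "gtgt G \<cdot> gmul G = gtgt G \<cdot> gfst G"
  using src_comp[of "gfst G" "Dom C (gfst G)" "gsnd G"]
    tgt_comp[of "gfst G" "Dom C (gfst G)" "gsnd G"] src_fst cmp_universal[of 0]
  by simp_all

lemma src_cmp:
  assumes "composable n g h"
  shows "src n \<cdot> cmp n g h = src n \<cdot> h"
proof -
  have "src n \<cdot> (T ^^ n) (gmul G) = src n \<cdot> (T ^^ n) (gsnd G)"
    using src_mul by (simp add: funpow_TAr_Comp[symmetric])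
  then have "src n \<cdot> (T ^^ n) (gmul G) \<cdot> comp_pair n g h
      = src n \<cdot> (T ^^ n) (gsnd G) \<cdot> comp_pair n g h"
    by (rule Comp_square_applied) (use assms in simp_all)
  then show ?thesis using comp_pair(3)[OF assms] by (simp add: gcomp_def)
qed

lemma tgt_cmp:
  assumes "composable n g h"
  shows "tgt n \<cdot> cmp n g h = tgt n \<cdot> g"
proof -
  have "tgt n \<cdot> (T ^^ n) (gmul G) = tgt n \<cdot> (T ^^ n) (gfst G)"
    using tgt_mul by (simp add: funpow_TAr_Comp[symmetric])
  then have "tgt n \<cdot> (T ^^ n) (gmul G) \<cdot> comp_pair n g h
      = tgt n \<cdot> (T ^^ n) (gfst G) \<cdot> comp_pair n g h"
    by (rule Comp_square_applied) (use assms in simp_all)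
  then show ?thesis using comp_pair(2)[OF assms] by (simp add: gcomp_def)
qed

lemma src_recip:
  assumes "g \<in> Arr C" "Cod C g = tot n"
  shows "src n \<cdot> recip n g = tgt n \<cdot> g"
proof -
  have "src n \<cdot> (T ^^ n) (ginv G) = tgt n \<cdot> Id C (tot n)"
    using src_inv by (simp add: funpow_TAr_Comp[symmetric])
  then have "src n \<cdot> (T ^^ n) (ginv G) \<cdot> g = tgt n \<cdot> Id C (tot n) \<cdot> g"
    by (rule Comp_square_applied) (use assms in simp_all)
  then show ?thesis using assms by (simp add: ginverse_def)
qed

lemma tgt_recip:
  assumes "g \<in> Arr C" "Cod C g = tot n"
  shows "tgt n \<cdot> recip n g = src n \<cdot> g"
proof -
  have "tgt n \<cdot> (T ^^ n) (ginv G) = src n \<cdot> Id C (tot n)"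
    using tgt_inv by (simp add: funpow_TAr_Comp[symmetric])
  then have "tgt n \<cdot> (T ^^ n) (ginv G) \<cdot> g = src n \<cdot> Id C (tot n) \<cdot> g"
    by (rule Comp_square_applied) (use assms in simp_all)
  then show ?thesis using assms by (simp add: ginverse_def)
qed

lemma tgt_unit': "tgt n \<cdot> (T ^^ n) (gunit G) = Id C ((TOb C ^^ n) (gbase G))"
  using tgt_unit by (simp add: funpow_TAr_Comp[symmetric] funpow_TAr_Id)

lemma composable_unit:
  assumes "g \<in> Arr C" "Cod C g = tot n"
  shows "composable n g ((T ^^ n) (gunit G) \<cdot> src n \<cdot> g)"
  using assms Comp_assoc'[of "src n \<cdot> g" "(T ^^ n) (gunit G)" "tgt n"]
  by (simp add: composable_iff tgt_unit')

lemma composable_recip: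
  assumes "g \<in> Arr C" "Cod C g = tot n"
  shows "composable n g (recip n g)" "composable n (recip n g) g"
  using assms by (simp_all add: composable_iff src_recip tgt_recip)

text \<open>The unit, inverse and associativity laws hold in \<open>T\<^sup>n(G)\<close>: \<open>T\<close> takes the law at the universal
  element of \<open>T\<^sup>n(G)\<close>, or of the object of composable triples in it, to the law at the universal
  element one level higher, and precomposition gives it at every element.\<close>

lemma cmp_unit:
  assumes "g \<in> Arr C" "Cod C g = tot n"
  shows "cmp n g ((T ^^ n) (gunit G) \<cdot> src n \<cdot> g) = g"
proof -
  have "cmp n (Id C (tot n)) ((T ^^ n) (gunit G) \<cdot> src n) = Id C (tot n)"
  proof (induction n)
    case 0
    show ?case using comp_unit[of "Id C (gtot G)"] by simp
  next
    case (Suc n)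
    have "composable n (Id C (tot n)) ((T ^^ n) (gunit G) \<cdot> src n)"
      using composable_unit[of "Id C (tot n)" n] by simp
    from T_cmp[OF this] show ?case using Suc.IH by simp
  qed
  then show ?thesis
    using cmp_Comp[of n "Id C (tot n)" "(T ^^ n) (gunit G) \<cdot> src n" g] assms
      composable_unit[of "Id C (tot n)" n] by simp
qed

lemma cmp_recip:
  assumes "g \<in> Arr C" "Cod C g = tot n"
  shows "cmp n g (recip n g) = (T ^^ n) (gunit G) \<cdot> tgt n \<cdot> g"
proof -
  have "cmp n (Id C (tot n)) (recip n (Id C (tot n))) = (T ^^ n) (gunit G) \<cdot> tgt n"
  proof (induction n)
    case 0
    show ?case using comp_inv[of "Id C (gtot G)"] by simp
  next
    case (Suc n)
    from T_cmp[OF composable_recip(1)[of "Id C (tot n)" n]] show ?case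
      using Suc.IH by (simp add: T_recip)
  qed
  then show ?thesis
    using cmp_Comp[OF composable_recip(1)[of "Id C (tot n)" n], of g] assms
    by (simp add: recip_Comp)
qed

lemma recip_cmp:
  assumes "g \<in> Arr C" "Cod C g = tot n"
  shows "cmp n (recip n g) g = (T ^^ n) (gunit G) \<cdot> src n \<cdot> g"
proof -
  have "cmp n (recip n (Id C (tot n))) (Id C (tot n)) = (T ^^ n) (gunit G) \<cdot> src n"
  proof (induction n)
    case 0
    show ?case using inv_comp[of "Id C (gtot G)"] by simp
  next
    case (Suc n)
    from T_cmp[OF composable_recip(2)[of "Id C (tot n)" n]] show ?case
      using Suc.IH by (simp add: T_recip)
  qed
  then show ?thesis
    using cmp_Comp[OF composable_recip(2)[of "Id C (tot n)" n], of g] assms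
    by (simp add: recip_Comp)
qed

lemma cmp_assoc:
  assumes gh: "composable n g h" and hk: "composable n h k"
  shows "cmp n (cmp n g h) k = cmp n g (cmp n h k)"
proof -
  obtain a b where ab: "\<And>n. pullback C ((T ^^ n) (gsnd G)) ((T ^^ n) (gfst G)) ((T ^^ n) a) ((T ^^ n) b)"
    using triples_preserved unfolding preserved_pullback_def by blast
  then have "a \<in> hom C (Dom C a) (Dom C (gsnd G))" "b \<in> hom C (Dom C a) (Dom C (gfst G))"
    and mid: "gsnd G \<cdot> a = gfst G \<cdot> b"
    using ab[of 0] unfolding pullback_def by simp_all
  then have [simp]: "a \<in> Arr C" "Cod C a = Dom C (gfst G)" "b \<in> Arr C" "Dom C b = Dom C a"
    "Cod C b = Dom C (gfst G)" by auto
  let ?g = "\<lambda>n. (T ^^ n) (gfst G \<cdot> a)" and ?h = "\<lambda>n. (T ^^ n) (gsnd G \<cdot> a)"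
    and ?k = "\<lambda>n. (T ^^ n) (gsnd G \<cdot> b)"
  have c1: "composable n (?g n) (?h n)" for n
    using composable_Comp[OF composable_universal, of "(T ^^ n) a" n] by (simp add: funpow_TAr_Comp)
  have c2: "composable n (?h n) (?k n)" for n
    using composable_Comp[OF composable_universal, of "(T ^^ n) b" n] by (simp add: funpow_TAr_Comp mid)
  have c3: "composable n (cmp n (?g n) (?h n)) (?k n)" for n
    using c1[of n] c2[of n] by (auto simp: composable_iff src_cmp)
  have c4: "composable n (?g n) (cmp n (?h n) (?k n))" for n
    using c1[of n] c2[of n] by (auto simp: composable_iff tgt_cmp)
  have univ: "cmp n (cmp n (?g n) (?h n)) (?k n) = cmp n (?g n) (cmp n (?h n) (?k n))" for n
  proof (induction n)
    case 0
    show ?case using comp_assoc[of "?g 0" "Dom C a" "?h 0" "?k 0"] c1[of 0] c2[of 0]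
      by (simp add: composable_iff)
  next
    case (Suc n)
    have "T (cmp n (cmp n (?g n) (?h n)) (?k n)) = T (cmp n (?g n) (cmp n (?h n) (?k n)))"
      by (simp only: Suc.IH)
    then have "cmp (Suc n) (cmp (Suc n) (T (?g n)) (T (?h n))) (T (?k n))
      = cmp (Suc n) (T (?g n)) (cmp (Suc n) (T (?h n)) (T (?k n)))"
      by (simp only: T_cmp[OF c1] T_cmp[OF c2] T_cmp[OF c3] T_cmp[OF c4])
    then show ?case by simp
  qed
  define u where "u = pair C ((T ^^ n) a) ((T ^^ n) b) (comp_pair n g h) (comp_pair n h k)"
  have dom: "Dom C h = Dom C g" using gh by (simp add: composable_iff)
  have "(T ^^ n) (gsnd G) \<cdot> comp_pair n g h = (T ^^ n) (gfst G) \<cdot> comp_pair n h k"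
    using comp_pair[OF gh] comp_pair[OF hk] by simp
  from pair_pullback[OF ab _ _ this, of "Dom C g"]
  have [simp]: "u \<in> Arr C" "Dom C u = Dom C g" "Cod C u = (TOb C ^^ n) (Dom C a)"
    and u: "(T ^^ n) a \<cdot> u = comp_pair n g h" "(T ^^ n) b \<cdot> u = comp_pair n h k"
    using gh hk dom by (auto simp: u_def)
  have g: "?g n \<cdot> u = g" "?h n \<cdot> u = h" "?k n \<cdot> u = k"
    using comp_pair[OF gh] comp_pair[OF hk] by (simp_all add: funpow_TAr_Comp u)
  have "cmp n (cmp n (?g n) (?h n)) (?k n) \<cdot> u = cmp n (?g n) (cmp n (?h n) (?k n)) \<cdot> u"
    by (simp only: univ)
  then show ?thesis using c1[of n] c2[of n] c3[of n] c4[of n]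
    by (simp add: cmp_Comp g composable_iff)
qed

lemma unit_cmp:
  assumes "g \<in> Arr C" "Cod C g = tot n"
  shows "cmp n ((T ^^ n) (gunit G) \<cdot> tgt n \<cdot> g) g = g"
proof -
  have *: "composable n g (recip n g)" "composable n (recip n g) g"
    using assms by (simp_all add: composable_recip)
  have "cmp n (cmp n g (recip n g)) g = cmp n g (cmp n (recip n g) g)"
    by (rule cmp_assoc[OF *])
  then show ?thesis using assms by (simp add: cmp_recip recip_cmp cmp_unit)
qed

lemma recip_cancel_left:
  assumes "composable n g h"
  shows "cmp n (recip n g) (cmp n g h) = h"
proof -
  have g: "g \<in> Arr C" "Cod C g = tot n" and h: "h \<in> Arr C" "Cod C h = tot n"
    and gh: "src n \<cdot> g = tgt n \<cdot> h"
    using assms by (auto simp: composable_iff)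
  have "cmp n (recip n g) (cmp n g h) = cmp n (cmp n (recip n g) g) h"
    by (simp add: cmp_assoc[OF composable_recip(2)[OF g] assms])
  then show ?thesis using gh unit_cmp[OF h] by (simp add: recip_cmp[OF g])
qed

lemma cancel_recip_right:
  assumes "composable n g h"
  shows "cmp n (cmp n g h) (recip n h) = g"
proof -
  have h: "h \<in> Arr C" "Cod C h = tot n" and g: "g \<in> Arr C" "Cod C g = tot n"
    and gh: "src n \<cdot> g = tgt n \<cdot> h"
    using assms by (auto simp: composable_iff)
  have "cmp n (cmp n g h) (recip n h) = cmp n g (cmp n h (recip n h))"
    by (rule cmp_assoc[OF assms composable_recip(1)[OF h]])
  then show ?thesis using gh cmp_unit[OF g] by (simp add: cmp_recip[OF h])
qed

text \<open>The identity \<open>a (b v p\<inverse>) q\<inverse> = (a b k\<inverse>) (k v l\<inverse>) (q p l\<inverse>)\<inverse>\<close> to which the flip axiom reduces.\<close>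
lemma conjugation_identity:
  assumes AB: "composable n a b" and BV: "composable n b v" and KV: "composable n k v"
    and QP: "composable n q p"
    and VP: "src n \<cdot> v = src n \<cdot> p" "Dom C p = Dom C v"
    and VL: "src n \<cdot> v = src n \<cdot> l" "l \<in> Arr C" "Dom C l = Dom C v" "Cod C l = tot n"
  shows "cmp n (cmp n a (cmp n (cmp n b v) (recip n p))) (recip n q)
    = cmp n (cmp n (cmp n (cmp n a b) (recip n k)) (cmp n (cmp n k v) (recip n l)))
        (recip n (cmp n (cmp n q p) (recip n l)))"
proof -
  have basic: "a \<in> Arr C" "b \<in> Arr C" "v \<in> Arr C" "k \<in> Arr C" "q \<in> Arr C" "p \<in> Arr C"
    "Cod C a = tot n" "Cod C b = tot n" "Cod C v = tot n" "Cod C k = tot n" "Cod C q = tot n"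
    "Cod C p = tot n" "Dom C a = Dom C v" "Dom C b = Dom C v" "Dom C k = Dom C v"
    "Dom C q = Dom C v"
    "src n \<cdot> a = tgt n \<cdot> b" "src n \<cdot> b = tgt n \<cdot> v" "src n \<cdot> k = tgt n \<cdot> v" "src n \<cdot> q = tgt n \<cdot> p"
    using assms by (auto simp: composable_iff)
  note s = basic VP(2) VL(2-4) VP(1)[symmetric] VL(1)[symmetric] composable_iff src_cmp tgt_cmp
    src_recip tgt_recip cmp_assoc recip_cancel_left
  let ?r = "cmp n (cmp n q p) (recip n l)"
    and ?lhs = "cmp n (cmp n a (cmp n (cmp n b v) (recip n p))) (recip n q)"
  \<comment> \<open>Multiplied by \<open>q p l\<inverse>\<close> on the right, the left-hand side becomes \<open>a b v l\<inverse>\<close>, which is also the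
    product of the first two factors on the right-hand side.\<close>
  have r: "composable n ?lhs ?r" by (simp add: s)
  have "cmp n ?lhs ?r = cmp n a (cmp n b (cmp n v (recip n l)))" by (simp add: s)
  also have "\<dots> = cmp n (cmp n (cmp n a b) (recip n k)) (cmp n (cmp n k v) (recip n l))"
    by (simp add: s)
  finally show ?thesis using cancel_recip_right[OF r] by simp
qed

end

section \<open>Functors between iterated tangent groupoids\<close>

context tangent_groupoid
begin

text \<open>\<open>F\<close> is the map of arrows of an internal functor \<open>T\<^sup>m(G) \<rightarrow> T\<^sup>n(G)\<close>; \<open>F\<^sub>0\<close> is its map of objects
  and \<open>F\<^sub>2\<close> its map of composable pairs. Since the conditions are equations between arrows, \<open>T\<close>
  preserves them, and a natural transformation satisfies them at once. Preservation of units is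
  automatic and therefore omitted.\<close>
definition groupoid_morphism :: "nat \<Rightarrow> nat \<Rightarrow> 'm \<Rightarrow> bool" where
  "groupoid_morphism m n F \<longleftrightarrow>
     (\<exists>F\<^sub>0 F\<^sub>2. F \<in> hom C (tot m) (tot n) \<and>
        F\<^sub>0 \<in> hom C ((TOb C ^^ m) (gbase G)) ((TOb C ^^ n) (gbase G)) \<and>
        F\<^sub>2 \<in> hom C ((TOb C ^^ m) (Dom C (gfst G))) ((TOb C ^^ n) (Dom C (gfst G))) \<and>
        src n \<cdot> F = F\<^sub>0 \<cdot> src m \<and> tgt n \<cdot> F = F\<^sub>0 \<cdot> tgt m \<and>
        (T ^^ n) (gfst G) \<cdot> F\<^sub>2 = F \<cdot> (T ^^ m) (gfst G) \<and>
        (T ^^ n) (gsnd G) \<cdot> F\<^sub>2 = F \<cdot> (T ^^ m) (gsnd G) \<and>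
        (T ^^ n) (gmul G) \<cdot> F\<^sub>2 = F \<cdot> (T ^^ m) (gmul G) \<and>
        (T ^^ n) (ginv G) \<cdot> F = F \<cdot> (T ^^ m) (ginv G))"

lemma groupoid_morphism_T:
  assumes "groupoid_morphism m n F"
  shows "groupoid_morphism (Suc m) (Suc n) (T F)"
proof -
  from assms obtain F0 F2 where F: "F \<in> hom C (tot m) (tot n)"
        "F0 \<in> hom C ((TOb C ^^ m) (gbase G)) ((TOb C ^^ n) (gbase G))"
        "F2 \<in> hom C ((TOb C ^^ m) (Dom C (gfst G))) ((TOb C ^^ n) (Dom C (gfst G)))"
        "src n \<cdot> F = F0 \<cdot> src m" "tgt n \<cdot> F = F0 \<cdot> tgt m"
        "(T ^^ n) (gfst G) \<cdot> F2 = F \<cdot> (T ^^ m) (gfst G)"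
        "(T ^^ n) (gsnd G) \<cdot> F2 = F \<cdot> (T ^^ m) (gsnd G)"
        "(T ^^ n) (gmul G) \<cdot> F2 = F \<cdot> (T ^^ m) (gmul G)"
        "(T ^^ n) (ginv G) \<cdot> F = F \<cdot> (T ^^ m) (ginv G)"
    unfolding groupoid_morphism_def by blast
  show ?thesis unfolding groupoid_morphism_def
    by (rule exI[of _ "T F0"], rule exI[of _ "T F2"])
      (use F in \<open>simp add: TAr_Comp[symmetric] del: TAr_Comp\<close>)
qed

lemma groupoid_morphism_composable:
  assumes F: "groupoid_morphism m n F" and gh: "composable m g h"
  shows "composable n (F \<cdot> g) (F \<cdot> h)"
proof -
  from F obtain F0 where F: "F \<in> hom C (tot m) (tot n)"
      "F0 \<in> hom C ((TOb C ^^ m) (gbase G)) ((TOb C ^^ n) (gbase G))"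
      "src n \<cdot> F = F0 \<cdot> src m" "tgt n \<cdot> F = F0 \<cdot> tgt m"
    unfolding groupoid_morphism_def by blast
  have "src n \<cdot> F \<cdot> g = F0 \<cdot> src m \<cdot> g"
    by (rule Comp_square_applied[OF F(3)]) (use F gh in \<open>auto simp: composable_iff\<close>)
  moreover have "tgt n \<cdot> F \<cdot> h = F0 \<cdot> tgt m \<cdot> h"
    by (rule Comp_square_applied[OF F(4)]) (use F gh in \<open>auto simp: composable_iff\<close>)
  moreover have "src m \<cdot> g = tgt m \<cdot> h" using gh by (simp add: composable_iff)
  ultimately have "src n \<cdot> F \<cdot> g = tgt n \<cdot> F \<cdot> h" by simp
  then show ?thesis using F gh by (simp add: composable_iff)
qed

lemma groupoid_morphism_cmp:
  assumes F: "groupoid_morphism m n F" and gh: "composable m g h"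
  shows "F \<cdot> cmp m g h = cmp n (F \<cdot> g) (F \<cdot> h)"
proof -
  from F obtain F2 where F: "F \<in> hom C (tot m) (tot n)"
        "F2 \<in> hom C ((TOb C ^^ m) (Dom C (gfst G))) ((TOb C ^^ n) (Dom C (gfst G)))"
        "(T ^^ n) (gfst G) \<cdot> F2 = F \<cdot> (T ^^ m) (gfst G)"
        "(T ^^ n) (gsnd G) \<cdot> F2 = F \<cdot> (T ^^ m) (gsnd G)"
        "(T ^^ n) (gmul G) \<cdot> F2 = F \<cdot> (T ^^ m) (gmul G)"
    unfolding groupoid_morphism_def by blast
  let ?u = "comp_pair m g h"
  have "(T ^^ n) (gfst G) \<cdot> F2 \<cdot> ?u = F \<cdot> (T ^^ m) (gfst G) \<cdot> ?u"
    "(T ^^ n) (gsnd G) \<cdot> F2 \<cdot> ?u = F \<cdot> (T ^^ m) (gsnd G) \<cdot> ?u"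
    and mul: "(T ^^ n) (gmul G) \<cdot> F2 \<cdot> ?u = F \<cdot> (T ^^ m) (gmul G) \<cdot> ?u"
    using F gh by (auto intro!: Comp_square_applied)
  then have "(T ^^ n) (gfst G) \<cdot> F2 \<cdot> ?u = F \<cdot> g" "(T ^^ n) (gsnd G) \<cdot> F2 \<cdot> ?u = F \<cdot> h"
    using comp_pair[OF gh] by simp_all
  then have "comp_pair n (F \<cdot> g) (F \<cdot> h) = F2 \<cdot> ?u"
    using comp_pair_unique[of "F2 \<cdot> ?u" "Dom C g" n] F gh by simp
  then show ?thesis using mul by (simp add: gcomp_def)
qed

lemma groupoid_morphism_recip:
  assumes F: "groupoid_morphism m n F" and g: "g \<in> Arr C" "Cod C g = tot m"
  shows "F \<cdot> recip m g = recip n (F \<cdot> g)"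
proof -
  have "F \<in> hom C (tot m) (tot n)" "(T ^^ n) (ginv G) \<cdot> F = F \<cdot> (T ^^ m) (ginv G)"
    using F unfolding groupoid_morphism_def by blast+
  then have "(T ^^ n) (ginv G) \<cdot> F \<cdot> g = F \<cdot> (T ^^ m) (ginv G) \<cdot> g"
    using g by (intro Comp_square_applied) auto
  then show ?thesis by (simp add: ginverse_def)
qed

lemma groupoid_morphism_tproj: "groupoid_morphism (Suc n) n (tproj C (tot n))"
  unfolding groupoid_morphism_def
  by (rule exI[of _ "tproj C ((TOb C ^^ n) (gbase G))"],
      rule exI[of _ "tproj C ((TOb C ^^ n) (Dom C (gfst G)))"])
    (use tproj_TAr[of "(T ^^ n) (gsrc G)"] tproj_TAr[of "(T ^^ n) (gtgt G)"]
       tproj_TAr[of "(T ^^ n) (gfst G)"] tproj_TAr[of "(T ^^ n) (gsnd G)"]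
       tproj_TAr[of "(T ^^ n) (gmul G)"] tproj_TAr[of "(T ^^ n) (ginv G)"] in simp)

lemma groupoid_morphism_tzero: "groupoid_morphism n (Suc n) (tzero C (tot n))"
  unfolding groupoid_morphism_def
  by (rule exI[of _ "tzero C ((TOb C ^^ n) (gbase G))"],
      rule exI[of _ "tzero C ((TOb C ^^ n) (Dom C (gfst G)))"])
    (use TAr_tzero[of "(T ^^ n) (gsrc G)"] TAr_tzero[of "(T ^^ n) (gtgt G)"]
       TAr_tzero[of "(T ^^ n) (gfst G)"] TAr_tzero[of "(T ^^ n) (gsnd G)"]
       TAr_tzero[of "(T ^^ n) (gmul G)"] TAr_tzero[of "(T ^^ n) (ginv G)"] in simp)

lemma groupoid_morphism_tflip:
  "groupoid_morphism (Suc (Suc n)) (Suc (Suc n)) (tflip C (tot n))"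
  unfolding groupoid_morphism_def
  by (rule exI[of _ "tflip C ((TOb C ^^ n) (gbase G))"],
      rule exI[of _ "tflip C ((TOb C ^^ n) (Dom C (gfst G)))"])
    (use TAr_tflip[of "(T ^^ n) (gsrc G)"] TAr_tflip[of "(T ^^ n) (gtgt G)"]
       TAr_tflip[of "(T ^^ n) (gfst G)"] TAr_tflip[of "(T ^^ n) (gsnd G)"]
       TAr_tflip[of "(T ^^ n) (gmul G)"] TAr_tflip[of "(T ^^ n) (ginv G)"] in simp)

text \<open>The shape \<open>a \<circ> b \<circ> k\<inverse>\<close> is that of the elements \<open>\<alpha>(v, w)\<close>.\<close>
lemma groupoid_morphism_quotient:
  assumes F: "groupoid_morphism m n F" and ab: "composable m a b"
    and abk: "composable m (cmp m a b) (recip m k)" and k: "k \<in> Arr C" "Cod C k = tot m"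
  shows "F \<cdot> cmp m (cmp m a b) (recip m k) = cmp n (cmp n (F \<cdot> a) (F \<cdot> b)) (recip n (F \<cdot> k))"
    and "composable n (cmp n (F \<cdot> a) (F \<cdot> b)) (recip n (F \<cdot> k))"
proof -
  show "composable n (cmp n (F \<cdot> a) (F \<cdot> b)) (recip n (F \<cdot> k))"
    using groupoid_morphism_composable[OF F abk]
    by (simp only: groupoid_morphism_cmp[OF F ab] groupoid_morphism_recip[OF F k])
  show "F \<cdot> cmp m (cmp m a b) (recip m k) = cmp n (cmp n (F \<cdot> a) (F \<cdot> b)) (recip n (F \<cdot> k))"
    by (simp only: groupoid_morphism_cmp[OF F abk] groupoid_morphism_cmp[OF F ab]
        groupoid_morphism_recip[OF F k])
qed

end

section \<open>The associated bundle and its prolongation\<close>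

text \<open>\<open>r1\<close>, \<open>r2\<close> are the projections of the prolongation of the anchored bundle \<open>A\<close> of \<open>G\<close>.\<close>
locale anchored_prolongation = tangent_groupoid C G
  for C :: "('o, 'm, 'z) tangent_category_scheme" (structure) and G :: "('o, 'm) groupoid" +
  fixes A :: 'o and \<pi> \<iota> \<rho> r1 r2 :: 'm
  assumes anchored: "associated_anchored_bundle C G A \<pi> \<iota> \<rho>"
    and prolongation: "preserved_pullback C \<rho> (T \<pi>) r1 r2"
begin

lemma incl_proj_Arr [simp]:
  "\<iota> \<in> Arr C" "Dom C \<iota> = A" "Cod C \<iota> = TOb C (gtot G)"
  "\<pi> \<in> Arr C" "Dom C \<pi> = A" "Cod C \<pi> = gbase G"
  and anchor_eq: "\<rho> = T (gtgt G) \<cdot> \<iota>"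
  using anchored by (auto simp: associated_anchored_bundle_def)

lemma A_Obj [simp]: "A \<in> Obj C"
  using Dom_Cod_Obj(1)[of \<iota>] by simp

text \<open>What the pullback defining \<open>A\<close> provides, in terms of the components of the two arrows into
  \<open>G \<times> T(M)\<close>.\<close>
lemma proj_incl: "tproj C (gtot G) \<cdot> \<iota> = gunit G \<cdot> \<pi>"
  and src_incl: "T (gsrc G) \<cdot> \<iota> = tzero C (gbase G) \<cdot> \<pi>"
  and incl_factor:
    "\<And>n X E u. \<lbrakk>E \<in> hom C X ((TOb C ^^ n) (TOb C (gtot G))); u \<in> hom C X ((TOb C ^^ n) (gbase G));
        (T ^^ n) (tproj C (gtot G)) \<cdot> E = (T ^^ n) (gunit G) \<cdot> u;
        (T ^^ n) (T (gsrc G)) \<cdot> E = (T ^^ n) (tzero C (gbase G)) \<cdot> u\<rbrakk>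
      \<Longrightarrow> \<exists>a. a \<in> hom C X ((TOb C ^^ n) A) \<and> (T ^^ n) \<iota> \<cdot> a = E \<and> (T ^^ n) \<pi> \<cdot> a = u"
  and incl_proj_jointly_monic:
    "\<And>n X a b. \<lbrakk>a \<in> hom C X ((TOb C ^^ n) A); b \<in> hom C X ((TOb C ^^ n) A);
        (T ^^ n) \<iota> \<cdot> a = (T ^^ n) \<iota> \<cdot> b; (T ^^ n) \<pi> \<cdot> a = (T ^^ n) \<pi> \<cdot> b\<rbrakk> \<Longrightarrow> a = b"
proof -
  obtain q1 q2 where cod: "Cod C q1 = gtot G" "Cod C q2 = TOb C (gbase G)"
    and prod: "\<And>n. binary_product C ((T ^^ n) q1) ((T ^^ n) q2)"
    and pb: "\<And>n. pullback C
          ((T ^^ n) (pair C q1 q2 (tproj C (gtot G)) (T (gsrc G))))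
          ((T ^^ n) (pair C q1 q2 (gunit G) (tzero C (gbase G)))) ((T ^^ n) \<iota>) ((T ^^ n) \<pi>)"
    using anchored unfolding associated_anchored_bundle_def preserved_product_def
      preserved_pullback_def by blast
  have q: "q1 \<in> Arr C" "q2 \<in> Arr C" "Dom C q2 = Dom C q1"
    using prod[of 0] unfolding binary_product_def by simp_all
  note [simp] = q cod
  define f where "f = pair C q1 q2 (tproj C (gtot G)) (T (gsrc G))"
  define g where "g = pair C q1 q2 (gunit G) (tzero C (gbase G))"
  have prod0: "binary_product C q1 q2" using prod[of 0] by simp
  have f: "f \<in> Arr C" "Dom C f = TOb C (gtot G)" "Cod C f = Dom C q1"
    "q1 \<cdot> f = tproj C (gtot G)" "q2 \<cdot> f = T (gsrc G)"
    using pair_product[OF prod0, of "tproj C (gtot G)" "TOb C (gtot G)" "T (gsrc G)"]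
    by (auto simp: f_def)
  have g: "g \<in> Arr C" "Dom C g = gbase G" "Cod C g = Dom C q1"
    "q1 \<cdot> g = gunit G" "q2 \<cdot> g = tzero C (gbase G)"
    using pair_product[OF prod0, of "gunit G" "gbase G" "tzero C (gbase G)"]
    by (auto simp: g_def)
  have fg: "f \<cdot> \<iota> = g \<cdot> \<pi>"
    using pb[of 0] unfolding pullback_def f_def[symmetric] g_def[symmetric] by simp
  show "tproj C (gtot G) \<cdot> \<iota> = gunit G \<cdot> \<pi>"
    using Comp_assoc'[of \<iota> f q1] Comp_assoc'[of \<pi> g q1] f g fg by simp
  show "T (gsrc G) \<cdot> \<iota> = tzero C (gbase G) \<cdot> \<pi>"
    using Comp_assoc'[of \<iota> f q2] Comp_assoc'[of \<pi> g q2] f g fg by simp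
  show "\<exists>a. a \<in> hom C X ((TOb C ^^ n) A) \<and> (T ^^ n) \<iota> \<cdot> a = E \<and> (T ^^ n) \<pi> \<cdot> a = u"
    if E: "E \<in> hom C X ((TOb C ^^ n) (TOb C (gtot G)))" and u: "u \<in> hom C X ((TOb C ^^ n) (gbase G))"
      and p: "(T ^^ n) (tproj C (gtot G)) \<cdot> E = (T ^^ n) (gunit G) \<cdot> u"
      and s: "(T ^^ n) (T (gsrc G)) \<cdot> E = (T ^^ n) (tzero C (gbase G)) \<cdot> u" for n X E u
  proof -
    have "(T ^^ n) f \<cdot> E = (T ^^ n) g \<cdot> u"
    proof (rule product_jointly_monic[OF prod[of n], of _ X])
      have "(T ^^ n) q1 \<cdot> (T ^^ n) f \<cdot> E = (T ^^ n) (q1 \<cdot> f) \<cdot> E"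
        using f(1-3) E by (simp add: funpow_TAr_Comp)
      moreover have "(T ^^ n) q1 \<cdot> (T ^^ n) g \<cdot> u = (T ^^ n) (q1 \<cdot> g) \<cdot> u"
        using g(1-3) u by (simp add: funpow_TAr_Comp)
      ultimately show "(T ^^ n) q1 \<cdot> (T ^^ n) f \<cdot> E = (T ^^ n) q1 \<cdot> (T ^^ n) g \<cdot> u"
        using f(4) g(4) p by simp
      have "(T ^^ n) q2 \<cdot> (T ^^ n) f \<cdot> E = (T ^^ n) (q2 \<cdot> f) \<cdot> E"
        using f(1-3) E by (simp add: funpow_TAr_Comp)
      moreover have "(T ^^ n) q2 \<cdot> (T ^^ n) g \<cdot> u = (T ^^ n) (q2 \<cdot> g) \<cdot> u"
        using g(1-3) u by (simp add: funpow_TAr_Comp)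
      ultimately show "(T ^^ n) q2 \<cdot> (T ^^ n) f \<cdot> E = (T ^^ n) q2 \<cdot> (T ^^ n) g \<cdot> u"
        using f(5) g(5) s by simp
    qed (use E u f(1-3) g(1-3) in simp_all)
    then show ?thesis
      using pair_pullback[OF pb[of n, folded f_def g_def], of E X u] E u f(1-3) g(1-3) by auto
  qed
  show "a = b" if "a \<in> hom C X ((TOb C ^^ n) A)" "b \<in> hom C X ((TOb C ^^ n) A)"
     "(T ^^ n) \<iota> \<cdot> a = (T ^^ n) \<iota> \<cdot> b" "(T ^^ n) \<pi> \<cdot> a = (T ^^ n) \<pi> \<cdot> b" for n X a b
    by (rule pullback_jointly_monic[OF pb[of n], of _ X]) (use that in simp_all)
qed

text \<open>Since \<open>\<pi> = t p \<iota>\<close>, the inclusion \<open>\<iota>\<close> alone is monic, and so are its images \<open>T\<^sup>n(\<iota>)\<close>.\<close>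
lemma proj_eq: "\<pi> = gtgt G \<cdot> tproj C (gtot G) \<cdot> \<iota>"
  using Comp_assoc'[of \<pi> "gunit G" "gtgt G"] tgt_unit by (simp add: proj_incl)

lemma incl_monic:
  assumes "a \<in> hom C X ((TOb C ^^ n) A)" "b \<in> hom C X ((TOb C ^^ n) A)"
    and eq: "(T ^^ n) \<iota> \<cdot> a = (T ^^ n) \<iota> \<cdot> b"
  shows "a = b"
proof (rule incl_proj_jointly_monic[OF assms(1-3)])
  have "(T ^^ n) \<pi> = (T ^^ n) (gtgt G \<cdot> tproj C (gtot G)) \<cdot> (T ^^ n) \<iota>"
    by (subst proj_eq) (simp add: funpow_TAr_Comp)
  then show "(T ^^ n) \<pi> \<cdot> a = (T ^^ n) \<pi> \<cdot> b" using assms by simp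
qed

lemma prolongation_Arr [simp]:
  "r1 \<in> Arr C" "Cod C r1 = A" "r2 \<in> Arr C" "Dom C r2 = Dom C r1" "Cod C r2 = TOb C A"
  and prolongation_commutes: "\<rho> \<cdot> r1 = T \<pi> \<cdot> r2"
  and prolongation_pullback: "pullback C ((T ^^ n) \<rho>) ((T ^^ n) (T \<pi>)) ((T ^^ n) r1) ((T ^^ n) r2)"
proof -
  show *: "pullback C ((T ^^ n) \<rho>) ((T ^^ n) (T \<pi>)) ((T ^^ n) r1) ((T ^^ n) r2)" for n
    using prolongation unfolding preserved_pullback_def by blast
  have "r1 \<in> hom C (Dom C r1) (Dom C \<rho>)" "r2 \<in> hom C (Dom C r1) (Dom C (T \<pi>))"
    and 2: "\<rho> \<cdot> r1 = T \<pi> \<cdot> r2"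
    using *[of 0] unfolding pullback_def by simp_all
  then show "r1 \<in> Arr C" "Cod C r1 = A" "r2 \<in> Arr C" "Dom C r2 = Dom C r1" "Cod C r2 = TOb C A"
    "\<rho> \<cdot> r1 = T \<pi> \<cdot> r2" by (auto simp: anchor_eq)
qed

lemma incl_simps:
  "\<And>u. \<lbrakk>u \<in> Arr C; Cod C u = A\<rbrakk> \<Longrightarrow> tproj C (gtot G) \<cdot> \<iota> \<cdot> u = gunit G \<cdot> \<pi> \<cdot> u"
  "\<And>u. \<lbrakk>u \<in> Arr C; Cod C u = A\<rbrakk> \<Longrightarrow> T (gsrc G) \<cdot> \<iota> \<cdot> u = tzero C (gbase G) \<cdot> \<pi> \<cdot> u"
  "\<And>u. \<lbrakk>u \<in> Arr C; Cod C u = TOb C A\<rbrakk> \<Longrightarrow> T (tproj C (gtot G)) \<cdot> T \<iota> \<cdot> u = T (gunit G) \<cdot> T \<pi> \<cdot> u"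
  "\<And>u. \<lbrakk>u \<in> Arr C; Cod C u = TOb C A\<rbrakk> \<Longrightarrow> T (T (gsrc G)) \<cdot> T \<iota> \<cdot> u = T (tzero C (gbase G)) \<cdot> T \<pi> \<cdot> u"
  "\<And>u. \<lbrakk>u \<in> Arr C; Cod C u = TOb C (TOb C A)\<rbrakk> \<Longrightarrow>
     T (T (T (gsrc G))) \<cdot> T (T \<iota>) \<cdot> u = T (T (tzero C (gbase G))) \<cdot> T (T \<pi>) \<cdot> u"
  "\<And>u. \<lbrakk>u \<in> Arr C; Cod C u = gbase G\<rbrakk> \<Longrightarrow> gtgt G \<cdot> gunit G \<cdot> u = u"
  "\<And>u. \<lbrakk>u \<in> Arr C; Cod C u = TOb C (gbase G)\<rbrakk> \<Longrightarrow> T (gtgt G) \<cdot> T (gunit G) \<cdot> u = u"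
proof -
  note e = proj_incl src_incl
  have t: "gtgt G \<cdot> gunit G = Id C (gbase G)" using tgt_unit by simp
  have T: "T f \<cdot> T g = T h \<cdot> T k" if "f \<cdot> g = h \<cdot> k" "f \<in> Arr C" "g \<in> Arr C" "h \<in> Arr C" "k \<in> Arr C"
    "Cod C g = Dom C f" "Cod C k = Dom C h" for f g h k
    using that by (simp add: TAr_Comp[symmetric] del: TAr_Comp)
  show "\<And>u. \<lbrakk>u \<in> Arr C; Cod C u = A\<rbrakk> \<Longrightarrow> tproj C (gtot G) \<cdot> \<iota> \<cdot> u = gunit G \<cdot> \<pi> \<cdot> u"
    by (rule Comp_square_applied[OF e(1)]) auto
  show "\<And>u. \<lbrakk>u \<in> Arr C; Cod C u = A\<rbrakk> \<Longrightarrow> T (gsrc G) \<cdot> \<iota> \<cdot> u = tzero C (gbase G) \<cdot> \<pi> \<cdot> u"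
    by (rule Comp_square_applied[OF e(2)]) auto
  show "\<And>u. \<lbrakk>u \<in> Arr C; Cod C u = TOb C A\<rbrakk> \<Longrightarrow> T (tproj C (gtot G)) \<cdot> T \<iota> \<cdot> u = T (gunit G) \<cdot> T \<pi> \<cdot> u"
    by (rule Comp_square_applied[OF T[OF e(1)]]) auto
  show "\<And>u. \<lbrakk>u \<in> Arr C; Cod C u = TOb C A\<rbrakk> \<Longrightarrow> T (T (gsrc G)) \<cdot> T \<iota> \<cdot> u = T (tzero C (gbase G)) \<cdot> T \<pi> \<cdot> u"
    by (rule Comp_square_applied[OF T[OF e(2)]]) auto
  show "\<And>u. \<lbrakk>u \<in> Arr C; Cod C u = TOb C (TOb C A)\<rbrakk> \<Longrightarrow>
     T (T (T (gsrc G))) \<cdot> T (T \<iota>) \<cdot> u = T (T (tzero C (gbase G))) \<cdot> T (T \<pi>) \<cdot> u"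
    by (rule Comp_square_applied[OF T[OF T[OF e(2)]]]) auto
  show "\<And>u. \<lbrakk>u \<in> Arr C; Cod C u = gbase G\<rbrakk> \<Longrightarrow> gtgt G \<cdot> gunit G \<cdot> u = u"
    by (subst Comp_eq_applied[OF t]) auto
  show "\<And>u. \<lbrakk>u \<in> Arr C; Cod C u = TOb C (gbase G)\<rbrakk> \<Longrightarrow> T (gtgt G) \<cdot> T (gunit G) \<cdot> u = u"
    by (subst Comp_eq_applied[OF T_Comp_eq[OF t]]) auto
qed

text \<open>A rewriting system for composites applied to an element of \<open>T\<^sup>n(A)\<close>. It reduces the source of
  such an element to zeros of its base point; images under the target remain.\<close>
lemmas nat_rules = tproj_TAr' TAr_tzero' TAr_tflip' T_tproj_TAr' T_TAr_tzero' T_TAr_tflip'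
  tangent_simps incl_simps

end

section \<open>The arrow from the prolongation\<close>

context anchored_prolongation
begin

context
  fixes X v w
  assumes v: "v \<in> hom C X A" and w: "w \<in> hom C X (TOb C A)"
    and vw: "\<rho> \<cdot> v = T \<pi> \<cdot> w"
begin

text \<open>The base points of \<open>w\<close> and of \<open>p w\<close> in terms of \<open>v\<close>.\<close>
lemma vw_simps: "v \<in> Arr C" "Dom C v = X" "Cod C v = A" "w \<in> Arr C" "Dom C w = X"
  "Cod C w = TOb C A" "T \<pi> \<cdot> w = T (gtgt G) \<cdot> \<iota> \<cdot> v" "\<pi> \<cdot> tproj C A \<cdot> w = \<pi> \<cdot> v"
proof -
  show *: "v \<in> Arr C" "Dom C v = X" "Cod C v = A" "w \<in> Arr C" "Dom C w = X"
    "Cod C w = TOb C A" using v w by auto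
  show **: "T \<pi> \<cdot> w = T (gtgt G) \<cdot> \<iota> \<cdot> v" using vw * by (simp add: anchor_eq)
  have "\<pi> \<cdot> tproj C A \<cdot> w = tproj C (gbase G) \<cdot> T \<pi> \<cdot> w"
    using * by (simp add: nat_rules)
  also have "\<dots> = \<pi> \<cdot> v" unfolding ** using * by (simp add: nat_rules)
  finally show "\<pi> \<cdot> tproj C A \<cdot> w = \<pi> \<cdot> v" .
qed

text \<open>Since \<open>c 0 = T(0)\<close>, the last factor of \<open>\<alpha>(v, w)\<close> is the inverse of \<open>T(0) p w\<close>.\<close>
lemma alpha_element_eq:
  "alpha_element C G \<iota> v w =
     cmp 2 (cmp 2 (tflip C (gtot G) \<cdot> T \<iota> \<cdot> w) (tzero C (TOb C (gtot G)) \<cdot> \<iota> \<cdot> v))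
       (recip 2 (T (tzero C (gtot G)) \<cdot> \<iota> \<cdot> tproj C A \<cdot> w))"
  by (simp add: alpha_element_def Let_def vw_simps nat_rules)

lemma alpha_composable:
  "composable 2 (tflip C (gtot G) \<cdot> T \<iota> \<cdot> w) (tzero C (TOb C (gtot G)) \<cdot> \<iota> \<cdot> v)" (is ?th1)
  "composable 2 (cmp 2 (tflip C (gtot G) \<cdot> T \<iota> \<cdot> w) (tzero C (TOb C (gtot G)) \<cdot> \<iota> \<cdot> v))
       (recip 2 (T (tzero C (gtot G)) \<cdot> \<iota> \<cdot> tproj C A \<cdot> w))"
proof -
  show *: ?th1
    by (simp add: composable_iff vw_simps nat_rules)
  show "composable 2 (cmp 2 (tflip C (gtot G) \<cdot> T \<iota> \<cdot> w) (tzero C (TOb C (gtot G)) \<cdot> \<iota> \<cdot> v))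
       (recip 2 (T (tzero C (gtot G)) \<cdot> \<iota> \<cdot> tproj C A \<cdot> w))"
    using src_cmp[OF *] tgt_recip[of "T (tzero C (gtot G)) \<cdot> \<iota> \<cdot> tproj C A \<cdot> w" 2] *
    by (simp add: composable_iff[of _ "cmp _ _ _"] vw_simps nat_rules)
qed


lemma alpha_element_Arr:
  "alpha_element C G \<iota> v w \<in> hom C X (TOb C (TOb C (gtot G)))"
  by (simp add: alpha_element_eq alpha_composable vw_simps)

lemma T_proj_alpha_element:
  "T (tproj C (gtot G)) \<cdot> alpha_element C G \<iota> v w
    = T (gunit G) \<cdot> T (gtgt G) \<cdot> \<iota> \<cdot> tproj C A \<cdot> w"
proof -
  have p: "groupoid_morphism 2 1 (T (tproj C (gtot G)))"
    using groupoid_morphism_T[OF groupoid_morphism_tproj[of 0]] by (simp add: numeral_2_eq_2)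
  let ?g = "\<iota> \<cdot> tproj C A \<cdot> w"
  have g: "?g \<in> Arr C" "Cod C ?g = tot 1" by (simp_all add: vw_simps)
  \<comment> \<open>\<open>T(p)\<close> sends \<open>\<alpha>(v, w)\<close> to \<open>p w \<circ> 0 p v \<circ> (p w)\<inverse>\<close>, and \<open>0 p v = 0 e m\<close> is a unit.\<close>
  have "T (gunit G) \<cdot> T (gsrc G) \<cdot> ?g = tzero C (gtot G) \<cdot> gunit G \<cdot> \<pi> \<cdot> v"
    by (simp add: vw_simps nat_rules)
  then have *: "cmp 1 ?g (tzero C (gtot G) \<cdot> gunit G \<cdot> \<pi> \<cdot> v) = ?g"
    using cmp_unit[OF g] by (simp add: vw_simps)
  show ?thesis
    using * cmp_recip[OF g]
    by (simp add: alpha_element_eq groupoid_morphism_cmp[OF p] groupoid_morphism_recip[OF p]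
        alpha_composable vw_simps nat_rules)
qed

lemma src_alpha_element:
  "T (T (gsrc G)) \<cdot> alpha_element C G \<iota> v w
    = T (tzero C (gbase G)) \<cdot> T (gtgt G) \<cdot> \<iota> \<cdot> tproj C A \<cdot> w"
  using src_cmp[OF alpha_composable(2)] src_recip[of "T (tzero C (gtot G)) \<cdot> \<iota> \<cdot> tproj C A \<cdot> w" 2]
  by (simp add: alpha_element_eq vw_simps nat_rules)

lemma tgt_alpha_element:
  "T (T (gtgt G)) \<cdot> alpha_element C G \<iota> v w = tflip C (gbase G) \<cdot> T (T (gtgt G)) \<cdot> T \<iota> \<cdot> w"
  using tgt_cmp[OF alpha_composable(2)] tgt_cmp[OF alpha_composable(1)]
  by (simp add: alpha_element_eq vw_simps nat_rules)

lemma alpha_element_Comp: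
  assumes "k \<in> Arr C" "Cod C k = X"
  shows "alpha_element C G \<iota> v w \<cdot> k
    = cmp 2 (cmp 2 (tflip C (gtot G) \<cdot> T \<iota> \<cdot> w \<cdot> k) (tzero C (TOb C (gtot G)) \<cdot> \<iota> \<cdot> v \<cdot> k))
       (recip 2 (T (tzero C (gtot G)) \<cdot> \<iota> \<cdot> tproj C A \<cdot> w \<cdot> k))"
  using assms by (simp add: alpha_element_eq cmp_Comp recip_Comp alpha_composable vw_simps)

end

abbreviation "\<alpha> \<equiv> alpha C G A \<pi> \<iota> \<rho> r1 r2"

lemma prolongation_pair:
  assumes "v \<in> hom C X A" "w \<in> hom C X (TOb C A)" "\<rho> \<cdot> v = T \<pi> \<cdot> w"
  shows "pair C r1 r2 v w \<in> hom C X (Dom C r1)"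
    and "r1 \<cdot> pair C r1 r2 v w = v" and "r2 \<cdot> pair C r1 r2 v w = w"
  using pair_pullback[OF prolongation_pullback[of 0], of v X w] assms by (simp_all add: anchor_eq)

lemma prolongation_pair_Id: "pair C r1 r2 r1 r2 = Id C (Dom C r1)"
  using pair_pullback_unique[OF prolongation_pullback[of 0], of "Id C (Dom C r1)" "Dom C r1"]
  by simp

text \<open>The defining property of \<open>\<alpha>\<close> determines a unique arrow: the element at the universal pair
  \<open>(r1, r2)\<close> lies in \<open>T(A)\<close>, over \<open>T(t) p r2\<close>.\<close>
lemma alpha_exists:
  "\<exists>!a. a \<in> hom C (Dom C r1) (TOb C A) \<and>
        (\<forall>X. \<forall>v\<in>hom C X A. \<forall>w\<in>hom C X (TOb C A).
           \<rho> \<cdot> v = T \<pi> \<cdot> w \<longrightarrow>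
           T \<iota> \<cdot> a \<cdot> pair C r1 r2 v w = alpha_element C G \<iota> v w)"
proof -
  let ?E = "alpha_element C G \<iota> r1 r2"
  have r: "r1 \<in> hom C (Dom C r1) A" "r2 \<in> hom C (Dom C r1) (TOb C A)" "\<rho> \<cdot> r1 = T \<pi> \<cdot> r2"
    using prolongation_commutes by simp_all
  note [simp] = prolongation_pair_Id
  obtain a where a: "a \<in> hom C (Dom C r1) (TOb C A)" and Ea: "T \<iota> \<cdot> a = ?E"
    using incl_factor[of ?E "Dom C r1" 1 "T (gtgt G) \<cdot> \<iota> \<cdot> tproj C A \<cdot> r2"]
      alpha_element_Arr[OF r] T_proj_alpha_element[OF r] src_alpha_element[OF r] by auto
  have spec: "T \<iota> \<cdot> a \<cdot> pair C r1 r2 v w = alpha_element C G \<iota> v w"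
    if vw: "v \<in> hom C X A" "w \<in> hom C X (TOb C A)" "\<rho> \<cdot> v = T \<pi> \<cdot> w" for X v w
  proof -
    note p = prolongation_pair[OF vw]
    have "T \<iota> \<cdot> a \<cdot> pair C r1 r2 v w = ?E \<cdot> pair C r1 r2 v w"
      using Comp_assoc'[of "pair C r1 r2 v w" a "T \<iota>"] a Ea p by simp
    also have "\<dots> = alpha_element C G \<iota> v w"
      using alpha_element_Comp[OF r, of "pair C r1 r2 v w"] alpha_element_eq[OF vw] p by simp
    finally show ?thesis .
  qed
  show ?thesis
  proof (rule ex1I[of _ a])
    fix b
    assume b: "b \<in> hom C (Dom C r1) (TOb C A) \<and>
        (\<forall>X. \<forall>v\<in>hom C X A. \<forall>w\<in>hom C X (TOb C A).
           \<rho> \<cdot> v = T \<pi> \<cdot> w \<longrightarrow>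
           T \<iota> \<cdot> b \<cdot> pair C r1 r2 v w = alpha_element C G \<iota> v w)"
    then have "T \<iota> \<cdot> b \<cdot> pair C r1 r2 r1 r2 = ?E" using r by blast
    then have "T \<iota> \<cdot> b = T \<iota> \<cdot> a" using Ea b by simp
    then show "b = a" using incl_monic[of b "Dom C r1" 1 a] a b by simp
  qed (use a spec in blast)
qed

lemma alpha_Arr [simp]: "\<alpha> \<in> Arr C" "Dom C \<alpha> = Dom C r1" "Cod C \<alpha> = TOb C A"
  and alpha_spec: "\<lbrakk>v \<in> hom C X A; w \<in> hom C X (TOb C A); \<rho> \<cdot> v = T \<pi> \<cdot> w\<rbrakk> \<Longrightarrow>
    T \<iota> \<cdot> \<alpha> \<cdot> pair C r1 r2 v w = alpha_element C G \<iota> v w"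
proof -
  have *: "\<alpha> \<in> hom C (Dom C r1) (TOb C A) \<and>
        (\<forall>X. \<forall>v\<in>hom C X A. \<forall>w\<in>hom C X (TOb C A).
           \<rho> \<cdot> v = T \<pi> \<cdot> w \<longrightarrow>
           T \<iota> \<cdot> \<alpha> \<cdot> pair C r1 r2 v w = alpha_element C G \<iota> v w)"
    unfolding alpha_def by (rule theI'[OF alpha_exists])
  then show "\<alpha> \<in> Arr C" "Dom C \<alpha> = Dom C r1" "Cod C \<alpha> = TOb C A" by auto
  show "\<lbrakk>v \<in> hom C X A; w \<in> hom C X (TOb C A); \<rho> \<cdot> v = T \<pi> \<cdot> w\<rbrakk> \<Longrightarrow>
    T \<iota> \<cdot> \<alpha> \<cdot> pair C r1 r2 v w = alpha_element C G \<iota> v w"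
    using * by blast
qed

lemma T_prolongation_pair:
  assumes "y \<in> hom C X (TOb C A)" "x \<in> hom C X (TOb C (TOb C A))" "T \<rho> \<cdot> y = T (T \<pi>) \<cdot> x"
  shows "pair C (T r1) (T r2) y x \<in> hom C X (TOb C (Dom C r1))"
    and "T r1 \<cdot> pair C (T r1) (T r2) y x = y" and "T r2 \<cdot> pair C (T r1) (T r2) y x = x"
  using pair_pullback[OF prolongation_pullback[of 1], of y X x] assms by (simp_all add: anchor_eq)

lemma alpha_universal: "T \<iota> \<cdot> \<alpha> = alpha_element C G \<iota> r1 r2"
  using alpha_spec[of r1 "Dom C r1" r2] prolongation_commutes by (simp add: prolongation_pair_Id)

context
  fixes X y x
  assumes y: "y \<in> hom C X (TOb C A)" and x: "x \<in> hom C X (TOb C (TOb C A))"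
    and yx: "T \<rho> \<cdot> y = T (T \<pi>) \<cdot> x"
begin

text \<open>\<open>T(\<alpha>)(y, x) = T(c) x \<circ> T(0) y \<circ> (T\<^sup>2(0) T(p) x)\<inverse>\<close>.\<close>
lemma T_alpha_composable:
  "composable 3 (T (tflip C (gtot G)) \<cdot> T (T \<iota>) \<cdot> x) (T (tzero C (TOb C (gtot G))) \<cdot> T \<iota> \<cdot> y)" (is ?th1)
  "composable 3 (cmp 3 (T (tflip C (gtot G)) \<cdot> T (T \<iota>) \<cdot> x) (T (tzero C (TOb C (gtot G))) \<cdot> T \<iota> \<cdot> y))
       (recip 3 (T (T (tzero C (gtot G))) \<cdot> T \<iota> \<cdot> T (tproj C A) \<cdot> x))" (is ?th2)
  and T_alpha_spec:
  "T (T \<iota>) \<cdot> T \<alpha> \<cdot> pair C (T r1) (T r2) y x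
    = cmp 3 (cmp 3 (T (tflip C (gtot G)) \<cdot> T (T \<iota>) \<cdot> x) (T (tzero C (TOb C (gtot G))) \<cdot> T \<iota> \<cdot> y))
       (recip 3 (T (T (tzero C (gtot G))) \<cdot> T \<iota> \<cdot> T (tproj C A) \<cdot> x))" (is ?th3)
proof -
  have r: "r1 \<in> hom C (Dom C r1) A" "r2 \<in> hom C (Dom C r1) (TOb C A)" "\<rho> \<cdot> r1 = T \<pi> \<cdot> r2"
    using prolongation_commutes by simp_all
  let ?k = "pair C (T r1) (T r2) y x"
  note k = T_prolongation_pair[OF y x yx]
  note c = alpha_composable[OF r]
  note Tc = T_composable[OF c(1)] T_composable[OF c(2)]
  show ?th1 using composable_Comp[OF Tc(1), of ?k] k by simp
  show ?th2 using composable_Comp[OF Tc(2), of ?k] k Tc c by (simp add: T_cmp T_recip cmp_Comp recip_Comp)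
  have "T (T \<iota>) \<cdot> T \<alpha> \<cdot> ?k = T (T \<iota> \<cdot> \<alpha>) \<cdot> ?k" using k by simp
  also have "\<dots> = T (alpha_element C G \<iota> r1 r2) \<cdot> ?k" by (simp only: alpha_universal)
  finally show ?th3 using k Tc c
    by (simp add: alpha_element_eq[OF r] T_cmp T_recip cmp_Comp recip_Comp)
qed

end

text \<open>The base point of \<open>T(\<alpha>)(y, x)\<close>: \<open>T(\<alpha>)\<close> lies over \<open>T\<^sup>2(t) T(p) x\<close> because \<open>\<alpha>(v, w)\<close> lies over
  \<open>T(t) p w\<close>.\<close>
lemma T_proj_alpha:
  assumes "y \<in> hom C X (TOb C A)" "x \<in> hom C X (TOb C (TOb C A))" "T \<rho> \<cdot> y = T (T \<pi>) \<cdot> x"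
  shows "T (T \<pi>) \<cdot> T \<alpha> \<cdot> pair C (T r1) (T r2) y x = T (T (gtgt G)) \<cdot> T \<iota> \<cdot> T (tproj C A) \<cdot> x"
proof -
  have r: "r1 \<in> hom C (Dom C r1) A" "r2 \<in> hom C (Dom C r1) (TOb C A)" "\<rho> \<cdot> r1 = T \<pi> \<cdot> r2"
    using prolongation_commutes by simp_all
  note k = T_prolongation_pair[OF assms]
  have "T \<pi> \<cdot> \<alpha> = T (gtgt G) \<cdot> T (gunit G) \<cdot> T \<pi> \<cdot> \<alpha>"
    by (simp add: nat_rules)
  also have "T (gunit G) \<cdot> T \<pi> \<cdot> \<alpha> = T (tproj C (gtot G)) \<cdot> T \<iota> \<cdot> \<alpha>"
    by (simp add: nat_rules)
  also have "\<dots> = T (gunit G) \<cdot> T (gtgt G) \<cdot> \<iota> \<cdot> tproj C A \<cdot> r2"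
    by (simp only: alpha_universal T_proj_alpha_element[OF r])
  also have "T (gtgt G) \<cdot> \<dots> = T (gtgt G) \<cdot> \<iota> \<cdot> tproj C A \<cdot> r2"
    by (simp add: nat_rules)
  finally have *: "T (T \<pi> \<cdot> \<alpha>) = T (T (gtgt G) \<cdot> \<iota> \<cdot> tproj C A \<cdot> r2)" by simp
  have "T (T \<pi>) \<cdot> T \<alpha> \<cdot> pair C (T r1) (T r2) y x
      = T (T \<pi> \<cdot> \<alpha>) \<cdot> pair C (T r1) (T r2) y x" using k by simp
  also have "\<dots> = T (T (gtgt G)) \<cdot> T \<iota> \<cdot> T (tproj C A) \<cdot> x"
    unfolding * using k by simp
  finally show ?thesis .
qed

end

section \<open>The flip axiom\<close>

context anchored_prolongation
begin

lemma flip_axiom: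
  assumes v: "v \<in> hom C X A" and w: "w \<in> hom C X (TOb C A)" and x: "x \<in> hom C X (TOb C (TOb C A))"
    and vw: "\<rho> \<cdot> v = T \<pi> \<cdot> w"
    and wx: "tflip C (gbase G) \<cdot> T \<rho> \<cdot> w = T (T \<pi>) \<cdot> x"
  shows "T \<alpha> \<cdot> pair C (T r1) (T r2) (\<alpha> \<cdot> pair C r1 r2 v w) x
    = tflip C A \<cdot> T \<alpha> \<cdot> pair C (T r1) (T r2)
          (\<alpha> \<cdot> pair C r1 r2 v (tproj C (TOb C A) \<cdot> x))
          (tflip C A \<cdot> T \<alpha> \<cdot> pair C (T r1) (T r2) w (tflip C A \<cdot> x))"
proof -
  \<comment> \<open>The equations below express the base points of \<open>w\<close>, \<open>x\<close> and their projections through the targets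
    of \<open>v\<close> and \<open>w\<close>, so that composability in \<open>T\<^sup>3(G)\<close> is decided by rewriting.\<close>
  note vws = vw_simps[OF v w vw]
  have xA: "x \<in> Arr C" "Dom C x = X" "Cod C x = TOb C (TOb C A)" using x by auto
  have xs: "T (T \<pi>) \<cdot> x = tflip C (gbase G) \<cdot> T (T (gtgt G)) \<cdot> T \<iota> \<cdot> w"
    using wx vws by (simp add: anchor_eq)
  have "T \<pi> \<cdot> tproj C (TOb C A) \<cdot> x = tproj C (TOb C (gbase G)) \<cdot> T (T \<pi>) \<cdot> x"
    using xA by (simp add: nat_rules)
  also have "\<dots> = T (gtgt G) \<cdot> \<iota> \<cdot> v"
    unfolding xs using vws by (simp add: nat_rules)
  finally have pxs: "T \<pi> \<cdot> tproj C (TOb C A) \<cdot> x = T (gtgt G) \<cdot> \<iota> \<cdot> v" .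
  have "\<pi> \<cdot> tproj C A \<cdot> tproj C (TOb C A) \<cdot> x = tproj C (gbase G) \<cdot> T \<pi> \<cdot> tproj C (TOb C A) \<cdot> x"
    using xA by (simp add: nat_rules)
  also have "\<dots> = \<pi> \<cdot> v" unfolding pxs using vws by (simp add: nat_rules)
  finally have ppxs: "\<pi> \<cdot> tproj C A \<cdot> tproj C (TOb C A) \<cdot> x = \<pi> \<cdot> v" .
  have "T \<pi> \<cdot> T (tproj C A) \<cdot> x = T (tproj C (gbase G)) \<cdot> T (T \<pi>) \<cdot> x"
    using xA by (simp add: nat_rules)
  also have "\<dots> = T (gtgt G) \<cdot> \<iota> \<cdot> tproj C A \<cdot> w"
    unfolding xs using vws by (simp add: nat_rules)
  finally have Tpxs: "T \<pi> \<cdot> T (tproj C A) \<cdot> x = T (gtgt G) \<cdot> \<iota> \<cdot> tproj C A \<cdot> w" .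
  note s = vws xA xs pxs ppxs Tpxs

  let ?px = "tproj C (TOb C A) \<cdot> x" and ?cx = "tflip C A \<cdot> x"
  have px: "?px \<in> hom C X (TOb C A)" "\<rho> \<cdot> v = T \<pi> \<cdot> ?px"
    and cx: "?cx \<in> hom C X (TOb C (TOb C A))" "T \<rho> \<cdot> w = T (T \<pi>) \<cdot> ?cx"
    by (simp_all add: s anchor_eq nat_rules)
  \<comment> \<open>The sides of the axiom are \<open>T(\<alpha>)(y1, x)\<close> and \<open>c T(\<alpha>)(y2, z)\<close> with \<open>z = c T(\<alpha>)(w, c x)\<close>.\<close>
  define y1 where "y1 = \<alpha> \<cdot> pair C r1 r2 v w"
  define y2 where "y2 = \<alpha> \<cdot> pair C r1 r2 v ?px"
  define z0 where "z0 = T \<alpha> \<cdot> pair C (T r1) (T r2) w ?cx"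
  define z where "z = tflip C A \<cdot> z0"
  have y1: "y1 \<in> hom C X (TOb C A)" "T \<iota> \<cdot> y1 = alpha_element C G \<iota> v w"
    using prolongation_pair[OF v w vw] alpha_spec[OF v w vw] by (simp_all add: y1_def)
  have y2: "y2 \<in> hom C X (TOb C A)" "T \<iota> \<cdot> y2 = alpha_element C G \<iota> v ?px"
    using prolongation_pair[OF v px] alpha_spec[OF v px] by (simp_all add: y2_def)
  have z0: "z0 \<in> hom C X (TOb C (TOb C A))"
    using T_prolongation_pair[OF w cx] by (simp add: z0_def)
  then have z: "z \<in> hom C X (TOb C (TOb C A))" by (simp add: z_def)
  have y1x: "T \<rho> \<cdot> y1 = T (T \<pi>) \<cdot> x"
    using y1 tgt_alpha_element[OF v w vw] by (simp add: anchor_eq s)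
  have "T (T \<pi>) \<cdot> z0 = T (T (gtgt G)) \<cdot> T \<iota> \<cdot> ?px"
    using T_proj_alpha[OF w cx] by (simp add: z0_def nat_rules xA)
  then have y2z: "T \<rho> \<cdot> y2 = T (T \<pi>) \<cdot> z"
    using y2 z0 tgt_alpha_element[OF v px] by (simp add: anchor_eq s z_def nat_rules)

  let ?N = "TOb C (gtot G)"
  let ?a = "T (tflip C (gtot G)) \<cdot> T (T \<iota>) \<cdot> x"
    and ?b = "T (tzero C ?N) \<cdot> tflip C (gtot G) \<cdot> T \<iota> \<cdot> w"
    and ?v = "tzero C (TOb C ?N) \<cdot> tzero C ?N \<cdot> \<iota> \<cdot> v"
    and ?p = "T (tzero C ?N) \<cdot> T (tzero C (gtot G)) \<cdot> \<iota> \<cdot> tproj C A \<cdot> w"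
    and ?q = "T (T (tzero C (gtot G))) \<cdot> T \<iota> \<cdot> T (tproj C A) \<cdot> x"
    and ?k = "tzero C (TOb C ?N) \<cdot> tflip C (gtot G) \<cdot> T \<iota> \<cdot> ?px"
    and ?l = "tzero C (TOb C ?N) \<cdot> T (tzero C (gtot G)) \<cdot> \<iota> \<cdot> tproj C A \<cdot> ?px"
  have zero: "groupoid_morphism 2 3 (tzero C (TOb C ?N))"
    using groupoid_morphism_tzero[of 2] by simp
  have T_zero: "groupoid_morphism 2 3 (T (tzero C ?N))"
    using groupoid_morphism_T[OF groupoid_morphism_tzero[of 1]] by (simp add: numeral_eq_Suc)
  have TT_zero: "groupoid_morphism 2 3 (T (T (tzero C (gtot G))))"
    using groupoid_morphism_T[OF groupoid_morphism_T[OF groupoid_morphism_tzero[of 0]]]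
    by (simp add: numeral_eq_Suc)
  have flip: "groupoid_morphism 3 3 (tflip C ?N)"
    using groupoid_morphism_tflip[of 1] by (simp add: numeral_eq_Suc)
  have T_flip: "groupoid_morphism 3 3 (T (tflip C (gtot G)))"
    using groupoid_morphism_T[OF groupoid_morphism_tflip[of 0]] by (simp add: numeral_eq_Suc)
  have proj: "groupoid_morphism 3 2 (tproj C (TOb C ?N))"
    using groupoid_morphism_tproj[of 2] by simp
  note morphs = zero T_zero TT_zero flip T_flip proj
  note push = morphs[THEN groupoid_morphism_quotient(1)] morphs[THEN groupoid_morphism_quotient(2)]
    morphs[THEN groupoid_morphism_composable]

  \<comment> \<open>Both sides of the axiom, as elements of \<open>T\<^sup>3(G)\<close>.\<close>
  have lhs: "T (T \<iota>) \<cdot> T \<alpha> \<cdot> pair C (T r1) (T r2) y1 x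
     = cmp 3 (cmp 3 ?a (cmp 3 (cmp 3 ?b ?v) (recip 3 ?p))) (recip 3 ?q)"
  proof -
    have "T (tzero C ?N) \<cdot> T \<iota> \<cdot> y1 = cmp 3 (cmp 3 ?b ?v) (recip 3 ?p)"
      using alpha_composable[OF v w vw] unfolding y1(2) alpha_element_eq[OF v w vw]
      by (simp add: push vws) (simp add: vws nat_rules)
    then show ?thesis using T_alpha_spec[OF y1(1) x y1x] by simp
  qed

  let ?za = "T (tflip C (gtot G)) \<cdot> T (T \<iota>) \<cdot> ?cx"
    and ?zb = "T (tzero C ?N) \<cdot> T \<iota> \<cdot> w"
    and ?zk = "T (T (tzero C (gtot G))) \<cdot> T \<iota> \<cdot> T (tproj C A) \<cdot> ?cx"
  have Z: "T (T \<iota>) \<cdot> z0 = cmp 3 (cmp 3 ?za ?zb) (recip 3 ?zk)"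
    using T_alpha_spec[OF w cx] by (simp add: z0_def)
  note Zc = T_alpha_composable[OF w cx]

  have rhs: "T (T \<iota>) \<cdot> tflip C A \<cdot> T \<alpha> \<cdot> pair C (T r1) (T r2) y2 z
     = cmp 3 (cmp 3 (cmp 3 (cmp 3 ?a ?b) (recip 3 ?k)) (cmp 3 (cmp 3 ?k ?v) (recip 3 ?l)))
        (recip 3 (cmp 3 (cmp 3 ?q ?p) (recip 3 ?l)))"
  proof -
    \<comment> \<open>Below, 1, 2 and 3 compute the three factors; the braid relation enters in 1.\<close>
    have "tflip C ?N \<cdot> T (tflip C (gtot G)) \<cdot> T (T \<iota>) \<cdot> z
        = tflip C ?N \<cdot> T (tflip C (gtot G)) \<cdot> tflip C ?N \<cdot> T (T \<iota>) \<cdot> z0"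
      using z0 by (simp add: z_def nat_rules)
    also have "\<dots> = cmp 3 (cmp 3 ?a ?b) (recip 3 ?k)"
      using Zc unfolding Z
      by (simp add: push s) (simp add: s nat_rules flip_braid' flip_flip_zero)
    finally have 1: "tflip C ?N \<cdot> T (tflip C (gtot G)) \<cdot> T (T \<iota>) \<cdot> z
      = cmp 3 (cmp 3 ?a ?b) (recip 3 ?k)" .

    have "tflip C ?N \<cdot> T (tzero C ?N) \<cdot> T \<iota> \<cdot> y2 = tzero C (TOb C ?N) \<cdot> T \<iota> \<cdot> y2"
      using y2(1) by (simp add: nat_rules)
    also have "\<dots> = cmp 3 (cmp 3 ?k ?v) (recip 3 ?l)"
      using alpha_composable[OF v px] unfolding y2(2) alpha_element_eq[OF v px]
      by (simp add: push s)
    finally have 2: "tflip C ?N \<cdot> T (tzero C ?N) \<cdot> T \<iota> \<cdot> y2 = cmp 3 (cmp 3 ?k ?v) (recip 3 ?l)" .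

    have "tflip C ?N \<cdot> T (T (tzero C (gtot G))) \<cdot> T \<iota> \<cdot> T (tproj C A) \<cdot> z
      = tflip C ?N \<cdot> T (T (tzero C (gtot G))) \<cdot> tproj C (TOb C ?N) \<cdot> T (T \<iota>) \<cdot> z0"
      using z0 by (simp add: z_def nat_rules)
    also have "\<dots> = cmp 3 (cmp 3 ?q ?p) (recip 3 ?l)"
      using Zc unfolding Z
      by (simp add: push s) (simp add: s nat_rules)
    finally have 3: "tflip C ?N \<cdot> T (T (tzero C (gtot G))) \<cdot> T \<iota> \<cdot> T (tproj C A) \<cdot> z
      = cmp 3 (cmp 3 ?q ?p) (recip 3 ?l)" .

    have "T (T \<iota>) \<cdot> tflip C A \<cdot> T \<alpha> \<cdot> pair C (T r1) (T r2) y2 z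
      = tflip C ?N \<cdot> T (T \<iota>) \<cdot> T \<alpha> \<cdot> pair C (T r1) (T r2) y2 z"
      using T_prolongation_pair[OF y2(1) z y2z] by (simp add: nat_rules)
    then show ?thesis
      using T_alpha_composable[OF y2(1) z y2z] y2(1) z
      by (simp add: T_alpha_spec[OF y2(1) z y2z] push 1 2 3)
  qed
  have "cmp 3 (cmp 3 ?a (cmp 3 (cmp 3 ?b ?v) (recip 3 ?p))) (recip 3 ?q)
    = cmp 3 (cmp 3 (cmp 3 (cmp 3 ?a ?b) (recip 3 ?k)) (cmp 3 (cmp 3 ?k ?v) (recip 3 ?l)))
        (recip 3 (cmp 3 (cmp 3 ?q ?p) (recip 3 ?l)))"
    by (rule conjugation_identity) (simp_all add: composable_iff s nat_rules TT_TAr_tzero' flip_flip_zero)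
  then have eq: "T (T \<iota>) \<cdot> T \<alpha> \<cdot> pair C (T r1) (T r2) y1 x
    = T (T \<iota>) \<cdot> tflip C A \<cdot> T \<alpha> \<cdot> pair C (T r1) (T r2) y2 z"
    using lhs rhs by simp
  have "T \<alpha> \<cdot> pair C (T r1) (T r2) y1 x = tflip C A \<cdot> T \<alpha> \<cdot> pair C (T r1) (T r2) y2 z"
    by (rule incl_monic[of _ X 2])
      (use T_prolongation_pair[OF y1(1) x y1x] T_prolongation_pair[OF y2(1) z y2z] eq in simp_all)
  then show ?thesis by (simp add: y1_def y2_def z_def z0_def)
qed

end

theorem lemma3p3p0p9:
  fixes C :: "('o, 'm, 'z) tangent_category_scheme" (structure)
    and G :: "('o, 'm) groupoid"
    and A X :: 'o
    and \<pi> \<iota> \<rho> r1 r2 \<alpha> v w x :: 'm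
  assumes "tangent_category C"
    and "internal_groupoid C G"
    and "associated_anchored_bundle C G A \<pi> \<iota> \<rho>"
    and "preserved_pullback C \<rho> (TAr C \<pi>) r1 r2"
    and "\<alpha> = alpha C G A \<pi> \<iota> \<rho> r1 r2"
    and "v \<in> hom C X A"
    and "w \<in> hom C X (TOb C A)"
    and "x \<in> hom C X (TOb C (TOb C A))"
    and "\<rho> \<cdot> v = TAr C \<pi> \<cdot> w"
    and "tflip C (gbase G) \<cdot> TAr C \<rho> \<cdot> w = TAr C (TAr C \<pi>) \<cdot> x"
  shows "TAr C \<alpha> \<cdot> pair C (TAr C r1) (TAr C r2) (\<alpha> \<cdot> pair C r1 r2 v w) x
    = tflip C A \<cdot> TAr C \<alpha> \<cdot>
        pair C (TAr C r1) (TAr C r2)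
          (\<alpha> \<cdot> pair C r1 r2 v (tproj C (TOb C A) \<cdot> x))
          (tflip C A \<cdot> TAr C \<alpha> \<cdot> pair C (TAr C r1) (TAr C r2) w (tflip C A \<cdot> x))"
proof -
  interpret tangent_category C by fact
  interpret internal_groupoid C G by fact
  interpret anchored_prolongation C G A \<pi> \<iota> \<rho> r1 r2
    by unfold_locales (fact assms(3,4))+
  show ?thesis unfolding \<open>\<alpha> = alpha C G A \<pi> \<iota> \<rho> r1 r2\<close>
    by (rule flip_axiom) (fact assms(6-10))+
qed

end
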